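(* Let $1<B<2$ and $0<\kappa<\min\left(\frac{B^2}{4},\frac12\right)$. There exist $\beta_0>0$ and constants $c_1,c_2>0$ such that for every $0\le\beta\le\beta_0$, every $u\in[0,1]$ and every integer $n\ge 0$, $$-c_2\beta^2\left(\frac{4\kappa}{B^2}\right)^n+\mathbf E_n\left[\exp\left(e^{-c_1\beta^2}uS_n\right)\right]\le \mathbf E_n\left[\exp(uS_n)\,e^{H^{\mathrm a}_{n,h_c^{\mathrm a}}}\right]\le \mathbf E_n\left[\exp\left(e^{c_1\beta^2}uS_n\right)\right],$$ where $h_c^{\mathrm a}=h_c^{\mathrm a}(\beta)$ is the annealed critical point. Consequently, for any $u\in[0,1]$, $$\mathtt F\left(e^{-c_1\beta^2}u\right)\le \mathtt F^{\mathrm a}(\beta,h_c^{\mathrm a}+u)\le \mathtt F\left(e^{c_1\beta^2}u\right).$$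
   Context: For $n\ge 0$, $\mathbf P_n$ (expectation $\mathbf E_n$) is the law of a random vector $(\delta_1,\dots,\delta_{2^n})\in\{0,1\}^{2^n}$ defined recursively: under $\mathbf P_0$, $\delta_1=1$; under $\mathbf P_{n+1}$, with probability $\frac{B-1}{B}$ all $\delta_i$ are $0$, and with probability $\frac1B$ the two vectors $(\delta_1,\dots,\delta_{2^n})$ and $(\delta_{2^n+1},\dots,\delta_{2^{n+1}})$ are independent, each with law $\mathbf P_n$. (Equivalently, $\delta_i$ indicates presence of leaf $i$ at generation $n$ of a Galton-Watson tree with offspring number $2$ with probability $1/B$ and $0$ with probability $(B-1)/B$.) Set $S_n=\sum_{i=1}^{2^n}\delta_i$. For $i,j\in\mathbb N=\{1,2,\dots\}$, the hierarchical distance $d(i,j)$ is the smallest $p\ge0$ such that $i$ and $j$ lie in a common block $\{(k-1)2^p+1,\dots,k2^p\}$, $k\in\mathbb N$. Set $\kappa_{ij}=\kappa^{d(i,j)}$ (so $\kappa_{ii}=1$). For $\beta\ge0$, $h\in\mathbb R$, the annealed Hamiltonian and partition function are $$H^{\mathrm a}_{n,h}=hS_n+\frac{\beta^2}{2}\sum_{i,j=1}^{2^n}\kappa_{ij}\delta_i\delta_j,\qquad Z^{\mathrm a}_{n,h}=\mathbf E_n\left[e^{H^{\mathrm a}_{n,h}}\right].$$ The annealed free energy is $\mathtt F^{\mathrm a}(\beta,h)=\lim_{n\to\infty}2^{-n}\log Z^{\mathrm a}_{n,h}$ (the limit exists, is finite and non-negative), and the annealed critical point is $h_c^{\mathrm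 a}(\beta)=\sup\{h:\mathtt F^{\mathrm a}(\beta,h)=0\}$, which is finite. The pure free energy is $\mathtt F(h)=\lim_{n\to\infty}2^{-n}\log\mathbf E_n[\exp(hS_n)]$. *)

theory Defs
  imports "HOL-Probability.Probability"
begin

text \<open>A configuration of the \<open>2 ^ n\<close> leaves at generation \<open>n\<close> is a list of booleans of length
  \<open>2 ^ n\<close>; \<open>delta w i\<close> is the indicator of leaf \<open>i\<close>, where leaves are numbered from 1.\<close>

definition delta :: "bool list \<Rightarrow> nat \<Rightarrow> real"
  where "delta w i = of_bool (w ! (i - 1))"

primrec GW_law :: "real \<Rightarrow> nat \<Rightarrow> bool list pmf"
  where
    "GW_law B 0 = return_pmf [True]"
  | "GW_law B (Suc n) =
       bind_pmf (bernoulli_pmf (1 / B))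
         (\<lambda>b. if b then map_pmf (\<lambda>(v, w). v @ w) (pair_pmf (GW_law B n) (GW_law B n))
              else return_pmf (replicate (2 ^ Suc n) False))"

definition leaves :: "nat \<Rightarrow> bool list \<Rightarrow> real"
  where "leaves n w = (\<Sum>i = 1..2 ^ n. delta w i)"

definition hdist :: "nat \<Rightarrow> nat \<Rightarrow> nat"
  where "hdist i j = (LEAST p. \<exists>k\<ge>1. i \<in> {(k - 1) * 2 ^ p + 1..k * 2 ^ p} \<and>
                                      j \<in> {(k - 1) * 2 ^ p + 1..k * 2 ^ p})"

definition annealed_hamiltonian :: "real \<Rightarrow> real \<Rightarrow> real \<Rightarrow> nat \<Rightarrow> bool list \<Rightarrow> real"
  where "annealed_hamiltonian \<kappa> \<beta> h n w =
    h * leaves n w +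
    \<beta>\<^sup>2 / 2 * (\<Sum>i = 1..2 ^ n. \<Sum>j = 1..2 ^ n. \<kappa> ^ hdist i j * delta w i * delta w j)"

definition annealed_partition :: "real \<Rightarrow> real \<Rightarrow> real \<Rightarrow> real \<Rightarrow> nat \<Rightarrow> real"
  where "annealed_partition B \<kappa> \<beta> h n =
    measure_pmf.expectation (GW_law B n) (\<lambda>w. exp (annealed_hamiltonian \<kappa> \<beta> h n w))"

text \<open>For \<open>1 < B\<close>, \<open>0 < \<kappa> < 1/2\<close> the following limit exists: \<open>Z (n + 1) \<ge> (Z n)\<^sup>2 / B\<close> makes
  \<open>ln (Z n / B) / 2 ^ n\<close> nondecreasing, and it is bounded because the Hamiltonian is at most a
  constant times \<open>2 ^ n\<close>. So \<open>lim\<close> is a genuine limit in this range.\<close>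

definition annealed_free_energy :: "real \<Rightarrow> real \<Rightarrow> real \<Rightarrow> real \<Rightarrow> real"
  where "annealed_free_energy B \<kappa> \<beta> h = lim (\<lambda>n. ln (annealed_partition B \<kappa> \<beta> h n) / 2 ^ n)"

definition annealed_critical_point :: "real \<Rightarrow> real \<Rightarrow> real \<Rightarrow> real"
  where "annealed_critical_point B \<kappa> \<beta> = Sup {h. annealed_free_energy B \<kappa> \<beta> h = 0}"

definition pure_free_energy :: "real \<Rightarrow> real \<Rightarrow> real"
  where "pure_free_energy B h =
    lim (\<lambda>n. ln (measure_pmf.expectation (GW_law B n) (\<lambda>w. exp (h * leaves n w))) / 2 ^ n)"

end

theory Submission
  imports Defs
begin

text \<open>
  Write \<open>S\<close>, \<open>S'\<close> for the numbers of leaves of the two subtrees and \<open>M\<^sub>n(k) = E\<^sub>n[S\<^sup>k exp H]\<close>,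
  with \<open>\<mu>\<^sub>n(k)\<close> for the moments of the pure model. The Hamiltonians of two generations are related by
  \<open>H\<^bsub>n+1\<^esub> = H\<^sub>n + H'\<^sub>n + \<beta>\<^sup>2 \<kappa>\<^bsup>n+1\<^esup> S S'\<close>. Expanding the exponential of the interaction and using
  \<open>\<mu>\<^sub>n(k+1) \<le> K b\<^sup>n \<surd>(k+1) \<mu>\<^sub>n(k)\<close> with \<open>b = max (2/B) (\<surd>2)\<close>, the interaction multiplies the \<open>k\<close>-th
  moment by at most a negative binomial series \<open>(1 - \<eta>\<^sub>n)\<^bsup>-(k+1)\<^esup>\<close>, where \<open>\<eta>\<^sub>n = A \<beta>\<^sup>2 (\<kappa> b\<^sup>2)\<^sup>n\<close> is summable.
  For \<open>k \<ge> 1\<close> this is absorbed in \<open>exp (4 \<eta>\<^sub>n k)\<close>; for \<open>k = 0\<close> it is not, and there one uses that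
  \<open>Z\<^sub>n = M\<^sub>n(0) \<le> 1\<close> for all \<open>n\<close> at criticality. Conversely, a value \<open>Z\<^sub>n\<close> below
  \<open>1 - C \<beta>\<^sup>2 (4\<kappa>/B\<^sup>2)\<^sup>n\<close> would be driven further away from the unstable fixed point \<open>1\<close>, also for
  \<open>h\<close> slightly above the critical point, which is impossible. Dropping the interaction then yields
  \<open>M\<^sub>n(k) \<ge> exp (- c \<beta>\<^sup>2 k) \<mu>\<^sub>n(k)\<close> for \<open>k \<ge> 1\<close>, and summing the moments against \<open>u\<^sup>k / k!\<close> gives both
  bounds on the Laplace transforms.
\<close>

section \<open>The recursive structure of the model\<close>

lemma finite_set_GW_law: "finite (set_pmf (GW_law B n))"
  by (induction n) (auto simp: set_bind_pmf split: if_splits)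

lemma length_GW_law: "w \<in> set_pmf (GW_law B n) \<Longrightarrow> length w = 2 ^ n"
  by (induction n arbitrary: w) (auto split: if_splits)

lemma expectation_GW_law_eq_sum:
  "measure_pmf.expectation (GW_law B n) f = (\<Sum>w\<in>set_pmf (GW_law B n). pmf (GW_law B n) w * (f w :: real))"
  by (subst integral_measure_pmf[OF finite_set_GW_law]) auto

text \<open>Conditioning on the offspring of the root. \<open>1 \<le> B\<close> makes
  \<open>1 / B\<close> a probability, and the iterated expectation integrates the two subtrees one
  after the other.\<close>

lemma expectation_GW_law_Suc:
  fixes f :: "bool list \<Rightarrow> real"
  assumes "1 \<le> B"
  shows "measure_pmf.expectation (GW_law B (Suc n)) f =
    (1 - 1 / B) * f (replicate (2 ^ Suc n) False) +
    1 / B * measure_pmf.expectation (GW_law B n)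
      (\<lambda>v. measure_pmf.expectation (GW_law B n) (\<lambda>w. f (v @ w)))"
proof -
  have pair: "measure_pmf.expectation (pair_pmf (GW_law B n) (GW_law B n)) g =
    measure_pmf.expectation (GW_law B n) (\<lambda>v. measure_pmf.expectation (GW_law B n) (\<lambda>w. g (v, w)))"
    for g :: "bool list \<times> bool list \<Rightarrow> real"
    unfolding pair_pmf_def map_pmf_def[symmetric] expectation_GW_law_eq_sum[of B n "\<lambda>v. measure_pmf.expectation _ (_ v)"]
    by (subst pmf_expectation_bind[OF finite_set_GW_law]) (auto simp: finite_set_GW_law map_pmf_def[symmetric])
  have "measure_pmf.expectation (GW_law B (Suc n)) f =
    (\<Sum>b\<in>UNIV. pmf (bernoulli_pmf (1 / B)) b *\<^sub>R measure_pmf.expectation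
      (if b then map_pmf (\<lambda>(v, w). v @ w) (pair_pmf (GW_law B n) (GW_law B n))
              else return_pmf (replicate (2 ^ Suc n) False)) f)"
    unfolding GW_law.simps
    by (intro pmf_expectation_bind) (auto simp: finite_set_GW_law)
  then show ?thesis
    using assms by (simp add: UNIV_bool pair case_prod_unfold)
qed

lemma expectation_GW_law_mono:
  fixes f g :: "bool list \<Rightarrow> real"
  assumes "\<And>w. length w = 2 ^ n \<Longrightarrow> f w \<le> g w"
  shows "measure_pmf.expectation (GW_law B n) f \<le> measure_pmf.expectation (GW_law B n) g"
  unfolding expectation_GW_law_eq_sum
  by (intro sum_mono mult_left_mono assms length_GW_law) auto

lemma expectation_GW_law_cong:
  fixes f g :: "bool list \<Rightarrow> real"
  assumes "\<And>w. length w = 2 ^ n \<Longrightarrow> f w = g w"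
  shows "measure_pmf.expectation (GW_law B n) f = measure_pmf.expectation (GW_law B n) g"
  by (rule antisym; rule expectation_GW_law_mono) (simp_all add: assms)

text \<open>The expectation is a finite sum, so it commutes with pointwise convergent
  series.\<close>

lemma expectation_GW_law_sums:
  fixes f :: "nat \<Rightarrow> bool list \<Rightarrow> real"
  assumes "\<And>w. (\<lambda>m. f m w) sums g w"
  shows "(\<lambda>m. measure_pmf.expectation (GW_law B n) (f m)) sums measure_pmf.expectation (GW_law B n) g"
  unfolding expectation_GW_law_eq_sum by (intro sums_sum sums_mult assms)

lemma expectation_GW_law_sum:
  fixes f :: "'a \<Rightarrow> bool list \<Rightarrow> real"
  shows "measure_pmf.expectation (GW_law B n) (\<lambda>w. \<Sum>x\<in>A. f x w) =
    (\<Sum>x\<in>A. measure_pmf.expectation (GW_law B n) (f x))"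
  unfolding expectation_GW_law_eq_sum sum_distrib_left by (rule sum.swap)

lemma sum_1_pow_Suc:
  fixes f :: "nat \<Rightarrow> real"
  shows "(\<Sum>i = 1..2 ^ Suc n. f i) = (\<Sum>i = 1..2 ^ n. f i) + (\<Sum>i = 1..2 ^ n. f (i + 2 ^ n))"
proof -
  have "(\<Sum>i = 1..2 ^ Suc n. f i) = (\<Sum>i = 1..2 ^ n. f i) + (\<Sum>i = 1 + 2 ^ n..2 ^ n + 2 ^ n. f i)"
    using sum.ub_add_nat[of 1 "2 ^ n" f "2 ^ n"] by (simp add: mult_2 add.commute)
  then show ?thesis
    by (simp only: sum.shift_bounds_cl_nat_ivl)
qed

lemma delta_append:
  assumes "length v = 2 ^ n" "i \<in> {1..2 ^ n}"
  shows "delta (v @ w) i = delta v i" "delta (v @ w) (i + 2 ^ n) = delta w i"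
  using assms by (auto simp: delta_def nth_append)

lemma leaves_append: "length v = 2 ^ n \<Longrightarrow> leaves (Suc n) (v @ w) = leaves n v + leaves n w"
  unfolding leaves_def sum_1_pow_Suc by (simp add: delta_append del: of_nat_add)

lemma leaves_nonneg: "0 \<le> leaves n w"
  unfolding leaves_def by (intro sum_nonneg) (simp add: delta_def)

lemma leaves_le: "leaves n w \<le> 2 ^ n"
proof -
  have "leaves n w \<le> (\<Sum>i = 1..(2::nat) ^ n. 1)"
    unfolding leaves_def by (intro sum_mono) (simp add: delta_def)
  then show ?thesis
    by simp
qed

lemma delta_replicate_False: "i \<in> {1..m} \<Longrightarrow> delta (replicate m False) i = 0"
  by (auto simp: delta_def)

lemma leaves_replicate_False: "leaves n (replicate (2 ^ n) False) = 0"
  unfolding leaves_def by (intro sum.neutral) (auto simp: delta_replicate_False simp del: replicate.simps)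

lemma annealed_hamiltonian_replicate_False:
  "annealed_hamiltonian \<kappa> \<beta> h n (replicate (2 ^ n) False) = 0"
  unfolding annealed_hamiltonian_def leaves_replicate_False
  by (simp add: delta_replicate_False)

section \<open>Hierarchical distance and splitting of the Hamiltonian\<close>

lemma hdist_eq_Least_div:
  assumes "1 \<le> i" "1 \<le> j"
  shows "hdist i j = (LEAST p. (i - 1) div 2 ^ p = (j - 1) div 2 ^ p)"
proof -
  \<comment> \<open>The blocks of size \<open>2 ^ p\<close> are the fibres of
    \<open>(i - 1) div 2 ^ p\<close>, block number \<open>k\<close> lying over \<open>k - 1\<close>;
    sharing a block becomes equality of quotients.\<close>
  have block: "i \<in> {(k - 1) * 2 ^ p + 1..k * 2 ^ p} \<longleftrightarrow> (i - 1) div 2 ^ p = k - 1"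
    if pos: "1 \<le> k" "1 \<le> i" for i k p :: nat
  proof -
    obtain l m where "k = Suc l" "i = Suc m"
      using pos by (metis One_nat_def Suc_le_D)
    moreover have "m div 2 ^ p = l" if "l * 2 ^ p \<le> m" "m < Suc l * 2 ^ p"
      using that by (intro div_nat_eqI) (simp_all add: mult.commute)
    moreover have "m div 2 ^ p * 2 ^ p \<le> m" "m < Suc (m div 2 ^ p) * 2 ^ p"
      by (simp_all add: dividend_less_div_times)
    ultimately show ?thesis
      by (auto simp: Suc_le_eq less_Suc_eq_le)
  qed
  have "(\<exists>k\<ge>1. i \<in> {(k - 1) * 2 ^ p + 1..k * 2 ^ p} \<and> j \<in> {(k - 1) * 2 ^ p + 1..k * 2 ^ p})
      \<longleftrightarrow> (i - 1) div 2 ^ p = (j - 1) div 2 ^ p" for p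
  proof
    assume "(i - 1) div 2 ^ p = (j - 1) div 2 ^ p"
    then show "\<exists>k\<ge>1. i \<in> {(k - 1) * 2 ^ p + 1..k * 2 ^ p} \<and> j \<in> {(k - 1) * 2 ^ p + 1..k * 2 ^ p}"
      by (intro exI[of _ "Suc ((i - 1) div 2 ^ p)"]) (simp only: block assms, simp)
  qed (auto simp only: block assms)
  then show ?thesis
    unfolding hdist_def by simp
qed

lemma hdist_self: "1 \<le> i \<Longrightarrow> hdist i i = 0"
  by (simp add: hdist_eq_Least_div)

text \<open>For \<open>p \<le> n\<close> the shift adds the same \<open>2 ^ (n - p)\<close> to both
  quotients. At \<open>p = n\<close> the unshifted quotients are both 0, so the least level is
  decided among \<open>p \<le> n\<close>.\<close>

lemma hdist_shift:
  assumes "i \<in> {1..2 ^ n}" "j \<in> {1..2 ^ n}"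
  shows "hdist (i + 2 ^ n) (j + 2 ^ n) = hdist i j"
proof -
  have shift: "(i + 2 ^ n - 1) div 2 ^ p = (i - 1) div 2 ^ p + 2 ^ (n - p)"
    if "p \<le> n" "1 \<le> i" for i p :: nat
  proof -
    have "(2::nat) ^ n = 2 ^ (n - p) * 2 ^ p"
      using that by (simp flip: power_add)
    then have "i + 2 ^ n - 1 = (i - 1) + 2 ^ (n - p) * 2 ^ p"
      using that by simp
    then show ?thesis
      by (simp only: div_mult_self1) simp
  qed
  have *: "(LEAST p. P p) = (LEAST p. Q p)" if "Q n" "\<And>p. p \<le> n \<Longrightarrow> P p \<longleftrightarrow> Q p" for P Q :: "nat \<Rightarrow> bool"
    using that by (smt (verit) LeastI Least_le le_trans order_antisym)
  show ?thesis
    using assms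
    by (subst (1 2) hdist_eq_Least_div) (auto intro!: * simp: shift[unfolded One_nat_def])
qed

text \<open>Up to level \<open>n\<close> the midpoint separates the two leaves, so their quotients
  differ; at level \<open>n + 1\<close> both quotients are 0.\<close>

lemma hdist_across:
  assumes "i \<in> {1..2 ^ n}" "j \<in> {1..2 ^ n}"
  shows "hdist i (j + 2 ^ n) = Suc n" "hdist (j + 2 ^ n) i = Suc n"
proof -
  have less: "(i - 1) div 2 ^ p < (j + 2 ^ n - 1) div 2 ^ p" if "p \<le> n" for p
  proof -
    have "(2::nat) ^ n = 2 ^ (n - p) * 2 ^ p"
      using that by (simp flip: power_add)
    then have "(i - 1) div 2 ^ p < 2 ^ (n - p)"
      using assms by (intro less_mult_imp_div_less) auto
    also have "(2::nat) ^ (n - p) = 2 ^ n div 2 ^ p"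
      using that by (simp add: power_diff)
    also have "\<dots> \<le> (j + 2 ^ n - 1) div 2 ^ p"
      using assms by (intro div_le_mono) auto
    finally show ?thesis .
  qed
  have eq: "(i - 1) div 2 ^ Suc n = 0" "(j + 2 ^ n - 1) div 2 ^ Suc n = 0"
    using assms by auto
  have *: "(LEAST p. P p) = Suc n" if "P (Suc n)" "\<And>p. p \<le> n \<Longrightarrow> \<not> P p" for P :: "nat \<Rightarrow> bool"
    using that by (intro Least_equality) (auto simp flip: not_less_eq_eq)
  show "hdist i (j + 2 ^ n) = Suc n" "hdist (j + 2 ^ n) i = Suc n"
    using assms less eq
    by (subst hdist_eq_Least_div; force intro!: * simp del: power_Suc dest: less_imp_neq)+
qed

text \<open>The double sum splits into four blocks. The diagonal ones reproduce generation
  \<open>n\<close>; the two off-diagonal ones have constant distance \<open>n + 1\<close> and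
  together cancel the factor \<open>1 / 2\<close>.\<close>

lemma annealed_hamiltonian_append:
  assumes "length v = 2 ^ n"
  shows "annealed_hamiltonian \<kappa> \<beta> h (Suc n) (v @ w) = annealed_hamiltonian \<kappa> \<beta> h n v +
    annealed_hamiltonian \<kappa> \<beta> h n w + \<beta>\<^sup>2 * \<kappa> ^ Suc n * leaves n v * leaves n w"
proof -
  define Q where "Q = (\<lambda>n w. \<Sum>i = 1..2 ^ n. \<Sum>j = 1..2 ^ n. \<kappa> ^ hdist i j * delta w i * delta w j)"
  have cross: "(\<Sum>i = 1..(2::nat) ^ n. \<Sum>j = 1..(2::nat) ^ n. \<kappa> ^ Suc n * f i * g j) = 
    \<kappa> ^ Suc n * sum f {1..2 ^ n} * sum g {1..2 ^ n}" for f g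
    unfolding mult.assoc sum_product by (simp only: sum_distrib_left)
  have blocks:
    "(\<Sum>i = 1..2 ^ n. \<Sum>j = 1..2 ^ n. \<kappa> ^ hdist i j * delta (v @ w) i * delta (v @ w) j) = Q n v"
    "(\<Sum>i = 1..2 ^ n. \<Sum>j = 1..2 ^ n. \<kappa> ^ hdist (i + 2 ^ n) (j + 2 ^ n) * delta (v @ w) (i + 2 ^ n) * delta (v @ w) (j + 2 ^ n)) = Q n w"
    "(\<Sum>i = 1..2 ^ n. \<Sum>j = 1..2 ^ n. \<kappa> ^ hdist i (j + 2 ^ n) * delta (v @ w) i * delta (v @ w) (j + 2 ^ n)) = \<kappa> ^ Suc n * leaves n v * leaves n w"
    "(\<Sum>i = 1..2 ^ n. \<Sum>j = 1..2 ^ n. \<kappa> ^ hdist (i + 2 ^ n) j * delta (v @ w) (i + 2 ^ n) * delta (v @ w) j) = \<kappa> ^ Suc n * leaves n w * leaves n v"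
    unfolding Q_def leaves_def cross[symmetric]
    by (intro sum.cong refl; simp only: delta_append[OF assms] hdist_across hdist_shift)+
  have "Q (Suc n) (v @ w) = Q n v + Q n w + 2 * \<kappa> ^ Suc n * leaves n v * leaves n w"
    unfolding Q_def sum_1_pow_Suc sum.distrib blocks[unfolded Q_def] by simp
  moreover have "annealed_hamiltonian \<kappa> \<beta> h m x = h * leaves m x + \<beta>\<^sup>2 / 2 * Q m x" for m x
    by (simp add: annealed_hamiltonian_def Q_def)
  ultimately show ?thesis
    by (simp add: leaves_append[OF assms] algebra_simps)
qed

section \<open>Moments\<close>

definition moment :: "real \<Rightarrow> real \<Rightarrow> real \<Rightarrow> real \<Rightarrow> nat \<Rightarrow> nat \<Rightarrow> real"
  where "moment B \<kappa> \<beta> h n k =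
    measure_pmf.expectation (GW_law B n) (\<lambda>w. leaves n w ^ k * exp (annealed_hamiltonian \<kappa> \<beta> h n w))"

text \<open>Mixed moment of two independent subtrees, weighted by their joint Hamiltonian including
  the interaction. The binomial theorem reduces the moments of generation \<open>n + 1\<close> to
  these.\<close>

definition joint_moment :: "real \<Rightarrow> real \<Rightarrow> real \<Rightarrow> real \<Rightarrow> nat \<Rightarrow> nat \<Rightarrow> nat \<Rightarrow> real"
  where "joint_moment B \<kappa> \<beta> h n j i =
    measure_pmf.expectation (GW_law B n) (\<lambda>v. measure_pmf.expectation (GW_law B n) (\<lambda>w.
      leaves n v ^ j * leaves n w ^ i * exp (annealed_hamiltonian \<kappa> \<beta> h n v +
        annealed_hamiltonian \<kappa> \<beta> h n w + \<beta>\<^sup>2 * \<kappa> ^ Suc n * leaves n v * leaves n w)))"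

lemma annealed_partition_eq_moment: "annealed_partition B \<kappa> \<beta> h n = moment B \<kappa> \<beta> h n 0"
  by (simp add: annealed_partition_def moment_def)

lemma annealed_hamiltonian_0: "annealed_hamiltonian \<kappa> \<beta> h 0 [True] = h + \<beta>\<^sup>2 / 2"
  by (simp add: annealed_hamiltonian_def leaves_def delta_def hdist_self)

lemma moment_0: "moment B \<kappa> \<beta> h 0 k = exp (h + \<beta>\<^sup>2 / 2)"
  by (simp add: moment_def annealed_hamiltonian_0) (simp add: leaves_def delta_def)

lemma moment_nonneg: "0 \<le> moment B \<kappa> \<beta> h n k"
  unfolding moment_def by (intro integral_nonneg_AE AE_I2) (simp add: leaves_nonneg)

lemma moment_Suc:
  assumes "1 \<le> B"
  shows "moment B \<kappa> \<beta> h (Suc n) k =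
    (1 - 1 / B) * 0 ^ k + 1 / B * (\<Sum>j\<le>k. (k choose j) * joint_moment B \<kappa> \<beta> h n j (k - j))"
proof -
  let ?E = "measure_pmf.expectation (GW_law B n)"
  have "?E (\<lambda>v. ?E (\<lambda>w. leaves (Suc n) (v @ w) ^ k * exp (annealed_hamiltonian \<kappa> \<beta> h (Suc n) (v @ w)))) =
    ?E (\<lambda>v. ?E (\<lambda>w. \<Sum>j\<le>k. (k choose j) * (leaves n v ^ j * leaves n w ^ (k - j) * exp (annealed_hamiltonian \<kappa> \<beta> h n v +
        annealed_hamiltonian \<kappa> \<beta> h n w + \<beta>\<^sup>2 * \<kappa> ^ Suc n * leaves n v * leaves n w))))"
    by (intro expectation_GW_law_cong)
      (simp only: leaves_append annealed_hamiltonian_append binomial_ring sum_distrib_right mult.assoc)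
  also have "\<dots> = (\<Sum>j\<le>k. (k choose j) * joint_moment B \<kappa> \<beta> h n j (k - j))"
    unfolding expectation_GW_law_sum joint_moment_def by (simp only: integral_mult_right_zero)
  finally show ?thesis
    unfolding moment_def expectation_GW_law_Suc[OF assms]
    by (simp only: leaves_replicate_False annealed_hamiltonian_replicate_False) simp
qed

text \<open>Powers of the interaction are products of powers of the two leaf counts, so after its
  exponential is expanded every term factorises over the subtrees.\<close>

lemma joint_moment_sums:
  "(\<lambda>m. (\<beta>\<^sup>2 * \<kappa> ^ Suc n) ^ m / fact m * (moment B \<kappa> \<beta> h n (j + m) * moment B \<kappa> \<beta> h n (i + m)))
    sums joint_moment B \<kappa> \<beta> h n j i"
proof -
  define H where "H = annealed_hamiltonian \<kappa> \<beta> h n"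
  let ?E = "measure_pmf.expectation (GW_law B n)"
  have "(\<lambda>m. (\<beta>\<^sup>2 * \<kappa> ^ Suc n) ^ m / fact m * ((leaves n v ^ (j + m) * exp (H v)) * (leaves n w ^ (i + m) * exp (H w))))
    sums (leaves n v ^ j * leaves n w ^ i * exp (H v + H w + \<beta>\<^sup>2 * \<kappa> ^ Suc n * leaves n v * leaves n w))" for v w
    using sums_mult[OF exp_converges[of "\<beta>\<^sup>2 * \<kappa> ^ Suc n * leaves n v * leaves n w"],
        of "leaves n v ^ j * leaves n w ^ i * exp (H v + H w)"]
    by (simp add: exp_add power_add power_mult_distrib mult_ac divide_inverse)
  then have "(\<lambda>m. ?E (\<lambda>v. ?E (\<lambda>w. (\<beta>\<^sup>2 * \<kappa> ^ Suc n) ^ m / fact m *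
      ((leaves n v ^ (j + m) * exp (H v)) * (leaves n w ^ (i + m) * exp (H w))))))
    sums joint_moment B \<kappa> \<beta> h n j i"
    unfolding joint_moment_def H_def[symmetric] by (intro expectation_GW_law_sums)
  then show ?thesis
    unfolding integral_mult_right_zero integral_mult_left_zero moment_def H_def .
qed

text \<open>Only the term \<open>m = 0\<close> of the nonnegative expansion is kept. This is how
  lower bounds drop the interaction.\<close>

lemma joint_moment_ge:
  assumes "0 \<le> \<kappa>"
  shows "moment B \<kappa> \<beta> h n j * moment B \<kappa> \<beta> h n i \<le> joint_moment B \<kappa> \<beta> h n j i"
proof (rule sums_le[OF _ sums_single[of 0] joint_moment_sums])
  show "(if m = 0 then moment B \<kappa> \<beta> h n j * moment B \<kappa> \<beta> h n i else 0)
    \<le> (\<beta>\<^sup>2 * \<kappa> ^ Suc n) ^ m / fact m * (moment B \<kappa> \<beta> h n (j + m) * moment B \<kappa> \<beta> h n (i + m))" for m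
    using assms by (simp add: moment_nonneg)
qed

lemma laplace_sums:
  "(\<lambda>k. u ^ k / fact k * moment B \<kappa> \<beta> h n k) sums
    measure_pmf.expectation (GW_law B n) (\<lambda>w. exp (u * leaves n w) * exp (annealed_hamiltonian \<kappa> \<beta> h n w))"
proof -
  define H where "H = annealed_hamiltonian \<kappa> \<beta> h n"
  have "(\<lambda>k. u ^ k / fact k * (leaves n w ^ k * exp (H w))) sums (exp (u * leaves n w) * exp (H w))" for w
    using sums_mult2[OF exp_converges[of "u * leaves n w"], of "exp (H w)"]
    by (simp add: power_mult_distrib mult_ac divide_inverse)
  then have "(\<lambda>k. measure_pmf.expectation (GW_law B n) (\<lambda>w. u ^ k / fact k * (leaves n w ^ k * exp (H w)))) sums
    measure_pmf.expectation (GW_law B n) (\<lambda>w. exp (u * leaves n w) * exp (H w))"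
    by (rule expectation_GW_law_sums)
  then show ?thesis
    unfolding integral_mult_right_zero moment_def H_def .
qed

section \<open>Moments of the pure model, the case of vanishing Hamiltonian\<close>

definition pure_moment :: "real \<Rightarrow> nat \<Rightarrow> nat \<Rightarrow> real"
  where "pure_moment B n k = moment B 0 0 0 n k"

lemma pure_moment_nonneg: "0 \<le> pure_moment B n k"
  by (simp add: pure_moment_def moment_nonneg)

lemma pure_moment_0_left: "pure_moment B 0 k = 1"
  by (simp add: pure_moment_def moment_0)

lemma pure_moment_0_right: "pure_moment B n 0 = 1"
  by (simp add: pure_moment_def moment_def annealed_hamiltonian_def)

lemma pure_laplace_sums:
  "(\<lambda>k. u ^ k / fact k * pure_moment B n k) sums
    measure_pmf.expectation (GW_law B n) (\<lambda>w. exp (u * leaves n w))"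
  using laplace_sums[of u B 0 0 0 n] by (simp add: pure_moment_def annealed_hamiltonian_def)

lemma pure_moment_Suc:
  assumes "1 \<le> B"
  shows "pure_moment B (Suc n) k = (1 - 1 / B) * 0 ^ k +
    1 / B * (\<Sum>j\<le>k. (k choose j) * (pure_moment B n j * pure_moment B n (k - j)))"
proof -
  have "joint_moment B 0 0 0 n j i = pure_moment B n j * pure_moment B n i" for i j
    unfolding pure_moment_def moment_def joint_moment_def by (simp add: annealed_hamiltonian_def)
  then show ?thesis
    by (simp add: moment_Suc[OF assms] pure_moment_def)
qed

lemma pure_moment_1: "1 \<le> B \<Longrightarrow> pure_moment B n 1 = (2 / B) ^ n"
  by (induction n) (auto simp: pure_moment_0_left pure_moment_0_right pure_moment_Suc)

text \<open>Pascal's rule in summed form. It rewrites a moment of order \<open>k + 1\<close> with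
  the weights of order \<open>k\<close>, so that the two orders can be compared term by
  term.\<close>

lemma sum_choose_Suc:
  fixes f :: "nat \<Rightarrow> real"
  shows "(\<Sum>j\<le>Suc k. (Suc k choose j) * f j) = (\<Sum>j\<le>k. (k choose j) * (f j + f (Suc j)))"
proof -
  have "(\<Sum>j\<le>Suc k. (Suc k choose j) * f j) =
    (\<Sum>j\<le>Suc k. (k choose j) * f j) + (\<Sum>j\<le>k. (k choose j) * f (Suc j))"
    by (simp only: sum.atMost_Suc_shift) (simp add: algebra_simps sum.distrib)
  then show ?thesis
    by (simp add: algebra_simps sum.distrib)
qed

text \<open>Newton's binomial series with exponent \<open>- (k + 1)\<close> at \<open>- x\<close>;
  the signs cancel once the coefficients are written as rising factorials.\<close>

lemma sums_pochhammer_geometric: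
  fixes x :: real
  assumes "0 \<le> x" "x < 1"
  shows "(\<lambda>m. pochhammer (real k + 1) m / fact m * x ^ m) sums (1 / (1 - x)) ^ Suc k"
proof -
  have "(\<lambda>m. ((- (real k + 1)) gchoose m) * (- x) ^ m) sums (1 + (- x)) powr (- (real k + 1))"
    using assms by (intro gen_binomial_real) auto
  moreover have "((- (real k + 1)) gchoose m) * (- x) ^ m = pochhammer (real k + 1) m / fact m * x ^ m" for m
    by (cases "even m") (simp_all add: gbinomial_pochhammer add.commute)
  moreover have "(1 + (- x)) powr (- (real k + 1)) = (1 / (1 - x)) ^ Suc k"
  proof -
    have "(1 + (- x)) powr (- (real k + 1)) = inverse ((1 - x) powr real (Suc k))"
      using powr_minus[of "1 - x" "real (Suc k)"] by (simp add: add.commute)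
    also have "(1 - x) powr real (Suc k) = (1 - x) ^ Suc k"
      using assms by (intro powr_realpow) auto
    finally show ?thesis
      by (simp only: power_one_over inverse_eq_divide)
  qed
  ultimately show ?thesis
    by simp
qed

lemma inverse_one_minus_le_exp:
  fixes x :: real
  assumes "0 \<le> x" "x \<le> 1 / 2"
  shows "1 / (1 - x) \<le> exp (2 * x)"
proof -
  have "- (2 * x) \<le> - x - 2 * x\<^sup>2"
    using assms mult_left_mono[of "2 * x" 1 x] by (simp add: power2_eq_square mult_ac)
  also have "\<dots> \<le> ln (1 - x)"
    using assms by (intro ln_one_minus_pos_lower_bound) auto
  finally have "exp (- (2 * x)) \<le> 1 - x"
    using assms by (simp add: ln_ge_iff)
  then show ?thesis
    using assms by (simp add: exp_minus field_simps)
qed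

lemma sum_power_le:
  fixes x :: real
  assumes "0 \<le> x" "x < 1"
  shows "(\<Sum>i<n. x ^ i) \<le> 1 / (1 - x)"
  using assms by (simp add: sum_gp_strict divide_right_mono)

section \<open>Growth of the pure moments\<close>

locale hierarchical_pinning =
  fixes B \<kappa> :: real
  assumes B_gt_1: "1 < B" and B_less_2: "B < 2"
    and \<kappa>_pos: "0 < \<kappa>" and \<kappa>_less: "\<kappa> < B\<^sup>2 / 4" and \<kappa>_less_half: "\<kappa> < 1 / 2"
begin

text \<open>One base for two growth rates: \<open>2 / B\<close> for the mean and
  \<open>sqrt 2\<close> for splitting \<open>sqrt k\<close> over two subtrees. The two upper bounds
  on \<kappa> say together that \<open>\<kappa> * b\<^sup>2 < 1\<close>.\<close>

definition b :: real
  where "b = max (2 / B) (sqrt 2)"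

text \<open>Chosen so that \<open>b ^ n + K * b ^ n = K * b ^ Suc n\<close>, which absorbs the
  contribution of a subtree carrying index 0.\<close>

definition K :: real
  where "K = 1 / (b - 1)"

lemma b_bounds: "1 < b" "b \<le> 2" "2 / B \<le> b" "sqrt 2 \<le> b"
proof -
  have "sqrt 2 \<le> 2"
    by (rule real_le_lsqrt) auto
  moreover have "2 / B \<le> 2"
    using B_gt_1 by (simp add: field_simps)
  ultimately show "b \<le> 2"
    by (simp add: b_def)
  show "1 < b" "2 / B \<le> b" "sqrt 2 \<le> b"
    by (auto simp: b_def less_max_iff_disj)
qed

lemma K_ge_1: "1 \<le> K"
  using b_bounds by (simp add: K_def)

text \<open>The coefficients on the right, as functions of \<open>k\<close>, dominate the growth of the moments because they satisfy
  \<open>r\<^bsub>n+1\<^esub>(k) \<ge> r\<^sub>n(j) + r\<^sub>n(k - j)\<close> for \<open>j \<le> k\<close> and \<open>k \<ge> 1\<close>: concavity of the square root costs a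
  factor \<open>sqrt 2 \<le> b\<close>.\<close>

lemma pure_moment_ratio:
  "pure_moment B n (Suc k) \<le> (if k = 0 then (2 / B) ^ n else K * b ^ n * sqrt k) * pure_moment B n k"
proof (induction n arbitrary: k)
  case 0
  have "1 \<le> K * sqrt k" if "k \<noteq> 0"
    using mult_mono[of 1 K 1 "sqrt k"] K_ge_1 that by simp
  then show ?case
    by (simp add: pure_moment_0_left)
next
  case (Suc n)
  define \<mu> where "\<mu> = pure_moment B n"
  define r where "r = (\<lambda>k. if k = 0 then (2 / B) ^ n else K * b ^ n * sqrt (real k))"
  have \<mu>_nonneg: "0 \<le> \<mu> j" for j
    by (simp add: \<mu>_def pure_moment_nonneg)
  have IH: "\<mu> (Suc j) \<le> r j * \<mu> j" for j
    using Suc.IH[of j] by (simp add: \<mu>_def r_def)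
  show ?case
  proof (cases "k = 0")
    case True
    then show ?thesis
      using pure_moment_1[of B "Suc n"] B_gt_1 by (simp add: pure_moment_0_right)
  next
    case False
    have r_0: "r 0 + r k \<le> K * b ^ Suc n * sqrt k"
    proof -
      have "(2 / B) ^ n \<le> b ^ n * 1"
        using b_bounds B_gt_1 by (simp add: power_mono)
      also have "\<dots> \<le> b ^ n * sqrt k"
        using False b_bounds by (intro mult_left_mono) auto
      also have "b ^ n * sqrt k = K * b ^ n * sqrt k * (b - 1)"
        using b_bounds by (simp add: K_def)
      finally show ?thesis
        using False by (simp add: r_def algebra_simps)
    qed
    have r_add: "r j + r (k - j) \<le> K * b ^ Suc n * sqrt k" if jk: "j \<le> k" for j
    proof -
      consider "j = 0" | "j = k" | "0 < j" "j < k"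
        using jk by linarith
      then show ?thesis
      proof cases
        case 3
        have "sqrt j + sqrt (k - j) \<le> sqrt (2 * k)"
        proof (rule real_le_rsqrt)
          have "0 \<le> (sqrt j - sqrt (k - j))\<^sup>2"
            by simp
          then show "(sqrt j + sqrt (k - j))\<^sup>2 \<le> 2 * k"
            using 3 by (simp add: power2_sum power2_diff of_nat_diff)
        qed
        also have "\<dots> \<le> b * sqrt k"
          using b_bounds by (simp add: real_sqrt_mult mult_right_mono)
        finally have "K * b ^ n * (sqrt j + sqrt (k - j)) \<le> K * b ^ n * (b * sqrt k)"
          using K_ge_1 b_bounds by (intro mult_left_mono) auto
        then show ?thesis
          using 3 by (simp add: r_def algebra_simps)
      qed (use r_0 in auto)
    qed
    have "(\<Sum>j\<le>Suc k. (Suc k choose j) * (\<mu> j * \<mu> (Suc k - j))) =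
      (\<Sum>j\<le>k. (k choose j) * (\<mu> j * \<mu> (Suc (k - j)) + \<mu> (Suc j) * \<mu> (k - j)))"
      unfolding sum_choose_Suc by (intro sum.cong) (auto simp: Suc_diff_le)
    also have "\<dots> \<le> (\<Sum>j\<le>k. (k choose j) * (K * b ^ Suc n * sqrt k * (\<mu> j * \<mu> (k - j))))"
    proof (intro sum_mono mult_left_mono)
      fix j
      assume "j \<in> {..k}"
      have "\<mu> j * \<mu> (Suc (k - j)) + \<mu> (Suc j) * \<mu> (k - j) \<le>
        \<mu> j * (r (k - j) * \<mu> (k - j)) + (r j * \<mu> j) * \<mu> (k - j)"
        by (intro add_mono mult_left_mono mult_right_mono IH \<mu>_nonneg)
      also have "\<dots> = (r j + r (k - j)) * (\<mu> j * \<mu> (k - j))"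
        by (simp add: algebra_simps)
      also have "\<dots> \<le> (K * b ^ Suc n * sqrt k) * (\<mu> j * \<mu> (k - j))"
        using \<open>j \<in> {..k}\<close> by (intro mult_right_mono r_add mult_nonneg_nonneg \<mu>_nonneg) auto
      finally show "\<mu> j * \<mu> (Suc (k - j)) + \<mu> (Suc j) * \<mu> (k - j) \<le> \<dots>" .
    qed simp
    also have "\<dots> = K * b ^ Suc n * sqrt k * (\<Sum>j\<le>k. (k choose j) * (\<mu> j * \<mu> (k - j)))"
      unfolding sum_distrib_left by (intro sum.cong) (auto simp: mult_ac)
    finally have "1 / B * (\<Sum>j\<le>Suc k. (Suc k choose j) * (\<mu> j * \<mu> (Suc k - j))) \<le>
      1 / B * (K * b ^ Suc n * sqrt k * (\<Sum>j\<le>k. (k choose j) * (\<mu> j * \<mu> (k - j))))"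
      using B_gt_1 by (intro mult_left_mono) auto
    moreover have "pure_moment B (Suc n) i = 1 / B * (\<Sum>j\<le>i. (i choose j) * (\<mu> j * \<mu> (i - j)))"
      if "i \<noteq> 0" for i
      using that B_gt_1 by (simp add: pure_moment_Suc \<mu>_def)
    ultimately show ?thesis
      using False by (simp only: nat.distinct if_False not_False_eq_True mult_ac)
  qed
qed

lemma pure_moment_ratio_sqrt: "pure_moment B n (Suc k) \<le> K * b ^ n * sqrt (real k + 1) * pure_moment B n k"
proof -
  have "(if k = 0 then (2 / B) ^ n else K * b ^ n * sqrt k) \<le> K * b ^ n * sqrt (real k + 1)"
  proof (cases "k = 0")
    case True
    have "1 * (2 / B) ^ n \<le> K * b ^ n"
      using K_ge_1 b_bounds B_gt_1 by (intro mult_mono power_mono) auto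
    then show ?thesis
      using True by simp
  next
    case False
    then show ?thesis
      using K_ge_1 b_bounds by (auto intro!: mult_left_mono)
  qed
  then show ?thesis
    using pure_moment_ratio[of n k] pure_moment_nonneg[of B n k] by (meson mult_right_mono order_trans)
qed

text \<open>The ratio bound is iterated \<open>m\<close> times in both factors, and the two square
  roots of each step merge into one linear factor. A single rising factorial results, so after
  division by \<open>fact m\<close> the bound is still summable for a weak interaction.\<close>

lemma pure_moment_product:
  "pure_moment B n (j + m) * pure_moment B n (i + m) \<le>
    (K\<^sup>2 * b ^ (2 * n)) ^ m * pochhammer (real (j + i) + 1) m * (pure_moment B n j * pure_moment B n i)"
proof (induction m)
  case (Suc m)
  have "sqrt (j + m + 1) * sqrt (i + m + 1) \<le> sqrt (j + i + 1 + m) * sqrt (j + i + 1 + m)"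
    by (intro mult_mono) auto
  also have "\<dots> = real (j + i) + 1 + m"
    by simp
  finally have sqrt_le: "sqrt (real (j + m) + 1) * sqrt (real (i + m) + 1) \<le> real (j + i) + 1 + m"
    by (simp add: add_ac)
  have "pure_moment B n (j + Suc m) * pure_moment B n (i + Suc m) \<le>
    (K * b ^ n * sqrt (real (j + m) + 1) * pure_moment B n (j + m)) *
    (K * b ^ n * sqrt (real (i + m) + 1) * pure_moment B n (i + m))"
    unfolding add_Suc_right using K_ge_1 b_bounds
    by (intro mult_mono pure_moment_ratio_sqrt pure_moment_nonneg mult_nonneg_nonneg) auto
  also have "\<dots> = K\<^sup>2 * b ^ (2 * n) * (sqrt (real (j + m) + 1) * sqrt (real (i + m) + 1)) *
      (pure_moment B n (j + m) * pure_moment B n (i + m))"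
    by (simp add: power2_eq_square power_mult mult_ac power_mult_distrib)
  also have "\<dots> \<le> K\<^sup>2 * b ^ (2 * n) * (real (j + i) + 1 + m) *
      ((K\<^sup>2 * b ^ (2 * n)) ^ m * pochhammer (real (j + i) + 1) m * (pure_moment B n j * pure_moment B n i))"
    using b_bounds K_ge_1
    by (intro mult_mono Suc.IH sqrt_le order_refl mult_nonneg_nonneg pure_moment_nonneg) auto
  finally show ?case
    by (simp add: pochhammer_Suc mult_ac)
qed simp

section \<open>Moments under the annealed measure\<close>

definition \<rho> :: real
  where "\<rho> = \<kappa> * b\<^sup>2"

definition q :: real
  where "q = 4 * \<kappa> / B\<^sup>2"

text \<open>\<open>K\<^sup>2\<close> comes from the two ratio bounds, \<kappa> from the extra power
  in \<open>\<kappa> ^ Suc n\<close>, and \<open>exp 1\<close> bounds \<open>exp (2 * c)\<close> for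
  \<open>c \<le> 1 / 2\<close>.\<close>

definition A :: real
  where "A = exp 1 * \<kappa> * K\<^sup>2"

text \<open>Here \<open>8 = 2 ^ 3\<close> bounds the cube of \<open>1 / (1 - \<eta>)\<close> for
  \<eta> at most \<open>1 / 2\<close>, \<open>exp 1\<close> again bounds \<open>exp (2 * c)\<close>,
  and \<open>1 / B\<close> is the branching probability.\<close>

definition D :: real
  where "D = 8 * exp 1 * \<kappa> / B"

lemma q_bounds: "0 < q" "q < 1"
  using \<kappa>_pos \<kappa>_less B_gt_1 by (auto simp: q_def field_simps)

lemma \<rho>_bounds: "0 < \<rho>" "\<rho> < 1"
proof -
  show "0 < \<rho>"
    using \<kappa>_pos b_bounds by (simp add: \<rho>_def)
  have "b = 2 / B \<or> b = sqrt 2"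
    by (auto simp: b_def max_def)
  then show "\<rho> < 1"
    using q_bounds \<kappa>_less_half by (auto simp: \<rho>_def q_def power_divide mult.commute)
qed

lemma A_pos: "0 < A"
  using \<kappa>_pos K_ge_1 by (simp add: A_def)

lemma D_pos: "0 < D"
  using \<kappa>_pos B_gt_1 by (simp add: D_def)

text \<open>\<open>A * \<beta>\<^sup>2 * \<rho> ^ n\<close> is the effective strength of the interaction \<open>\<beta>\<^sup>2 * \<kappa> ^ (n + 1) * S * S'\<close> between
  two subtrees; it is summable in \<open>n\<close> precisely because \<open>\<kappa> * max (4 / B\<^sup>2) 2 < 1\<close>.\<close>

lemma joint_moment_term_le:
  assumes c: "c \<le> 1 / 2"
    and M: "\<And>k. moment B \<kappa> \<beta> h n k \<le> exp (c * k) * pure_moment B n k"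
  shows "(\<beta>\<^sup>2 * \<kappa> ^ Suc n) ^ m / fact m * (moment B \<kappa> \<beta> h n (j + m) * moment B \<kappa> \<beta> h n (i + m)) \<le>
    exp (c * real (j + i)) * (pure_moment B n j * pure_moment B n i) *
    (pochhammer (real (j + i) + 1) m / fact m * (A * \<beta>\<^sup>2 * \<rho> ^ n) ^ m)"
proof -
  let ?\<mu> = "pure_moment B n"
  have "moment B \<kappa> \<beta> h n (j + m) * moment B \<kappa> \<beta> h n (i + m) \<le>
    (exp (c * real (j + m)) * ?\<mu> (j + m)) * (exp (c * real (i + m)) * ?\<mu> (i + m))"
    by (intro mult_mono M moment_nonneg mult_nonneg_nonneg pure_moment_nonneg exp_ge_zero)
  also have "\<dots> = exp (c * real (j + i)) * exp (2 * c * m) * (?\<mu> (j + m) * ?\<mu> (i + m))"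
    by (simp add: exp_add[symmetric] algebra_simps mult_exp_exp)
  also have "\<dots> \<le> exp (c * real (j + i)) * exp 1 ^ m *
    ((K\<^sup>2 * b ^ (2 * n)) ^ m * pochhammer (real (j + i) + 1) m * (?\<mu> j * ?\<mu> i))"
  proof (rule mult_mono[OF mult_left_mono pure_moment_product])
    show "exp (2 * c * m) \<le> exp 1 ^ m"
      using c mult_left_mono[of "2 * c" 1 "real m"] by (simp flip: exp_of_nat_mult add: mult_ac)
  qed (auto intro!: mult_nonneg_nonneg pure_moment_nonneg)
  finally have "(\<beta>\<^sup>2 * \<kappa> ^ Suc n) ^ m / fact m * (moment B \<kappa> \<beta> h n (j + m) * moment B \<kappa> \<beta> h n (i + m)) \<le>
    (\<beta>\<^sup>2 * \<kappa> ^ Suc n) ^ m / fact m * (exp (c * real (j + i)) * exp 1 ^ m *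
    ((K\<^sup>2 * b ^ (2 * n)) ^ m * pochhammer (real (j + i) + 1) m * (?\<mu> j * ?\<mu> i)))"
    using \<kappa>_pos by (intro mult_left_mono) auto
  also have "\<dots> = exp (c * real (j + i)) * (?\<mu> j * ?\<mu> i) * (pochhammer (real (j + i) + 1) m / fact m *
    ((\<beta>\<^sup>2 * \<kappa> ^ Suc n) * exp 1 * (K\<^sup>2 * b ^ (2 * n))) ^ m)"
    by (simp only: power_mult_distrib) (simp add: mult_ac)
  also have "(\<beta>\<^sup>2 * \<kappa> ^ Suc n) * exp 1 * (K\<^sup>2 * b ^ (2 * n)) = A * \<beta>\<^sup>2 * \<rho> ^ n"
    by (simp add: A_def \<rho>_def power_mult_distrib) (simp add: power_mult)
  finally show ?thesis .
qed

lemma joint_moment_le: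
  assumes c: "c \<le> 1 / 2"
    and M: "\<And>k. moment B \<kappa> \<beta> h n k \<le> exp (c * k) * pure_moment B n k"
    and \<eta>: "A * \<beta>\<^sup>2 * \<rho> ^ n < 1"
  shows "joint_moment B \<kappa> \<beta> h n j i \<le>
    exp (c * real (j + i)) * (1 / (1 - A * \<beta>\<^sup>2 * \<rho> ^ n)) ^ Suc (j + i) * (pure_moment B n j * pure_moment B n i)"
proof -
  have "0 \<le> A * \<beta>\<^sup>2 * \<rho> ^ n"
    using A_pos \<rho>_bounds by simp
  from sums_pochhammer_geometric[OF this \<eta>]
  have "joint_moment B \<kappa> \<beta> h n j i \<le> exp (c * real (j + i)) * (pure_moment B n j * pure_moment B n i) *
    (1 / (1 - A * \<beta>\<^sup>2 * \<rho> ^ n)) ^ Suc (j + i)"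
    using joint_moment_term_le[OF c M] by (intro sums_le[OF _ joint_moment_sums sums_mult])
  then show ?thesis
    by (simp only: mult_ac)
qed

text \<open>The general bound at \<open>j = i = 0\<close> would only give an error of order
  \<open>\<rho> ^ n\<close>. Keeping the term \<open>m = 0\<close> exactly leaves a tail led by the
  squared first moments \<open>(4 / B\<^sup>2) ^ n\<close>, which yields the rate
  \<open>q ^ n\<close>.\<close>

lemma joint_moment_0_0_le:
  assumes c: "c \<le> 1 / 2"
    and M: "\<And>k. moment B \<kappa> \<beta> h n k \<le> exp (c * k) * pure_moment B n k"
    and \<eta>: "A * \<beta>\<^sup>2 * \<rho> ^ n \<le> 1 / 2"
  shows "joint_moment B \<kappa> \<beta> h n 0 0 \<le> (moment B \<kappa> \<beta> h n 0)\<^sup>2 + B * D * \<beta>\<^sup>2 * q ^ n"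
proof -
  define \<epsilon> where "\<epsilon> = \<beta>\<^sup>2 * \<kappa> ^ Suc n"
  define \<eta>' where "\<eta>' = A * \<beta>\<^sup>2 * \<rho> ^ n"
  define M where "M = moment B \<kappa> \<beta> h n"
  have \<epsilon>_nonneg: "0 \<le> \<epsilon>"
    using \<kappa>_pos by (simp add: \<epsilon>_def)
  have M_nonneg: "0 \<le> M k" for k
    by (simp add: M_def moment_nonneg)
  have \<eta>'_nonneg: "0 \<le> \<eta>'"
    using A_pos \<rho>_bounds by (simp add: \<eta>'_def)
  have "(\<lambda>m. \<epsilon> ^ m / fact m * (M (0 + m) * M (0 + m))) sums joint_moment B \<kappa> \<beta> h n 0 0"
    unfolding \<epsilon>_def M_def by (rule joint_moment_sums)
  then have tail: "(\<lambda>m. \<epsilon> ^ Suc m / fact (Suc m) * (M (Suc m) * M (Suc m))) sums (joint_moment B \<kappa> \<beta> h n 0 0 - (M 0)\<^sup>2)"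
    by (subst sums_Suc_iff) (simp add: power2_eq_square)
  have "pure_moment B n 1 = (2 / B) ^ n"
    using B_gt_1 by (intro pure_moment_1) simp
  then have \<mu>_1: "pure_moment B n 1 * pure_moment B n 1 = (4 / B\<^sup>2) ^ n"
    by (simp add: power2_eq_square flip: power_mult_distrib)
  have "\<epsilon> ^ Suc m / fact (Suc m) * (M (Suc m) * M (Suc m)) \<le>
    \<epsilon> * exp 1 * (4 / B\<^sup>2) ^ n * (pochhammer (real 2 + 1) m / fact m * \<eta>' ^ m)" for m
  proof -
    \<comment> \<open>Weakening \<open>fact (Suc m)\<close> to \<open>fact m\<close> turns the tail
      into \<epsilon> times the series for \<open>j = i = 1\<close>, hence the rising factorial from
      3 and the cube of the geometric factor.\<close>
    have "\<epsilon> ^ Suc m / fact (Suc m) * (M (Suc m) * M (Suc m)) \<le>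
        \<epsilon> ^ Suc m / fact m * (M (Suc m) * M (Suc m))"
      using \<epsilon>_nonneg M_nonneg by (intro mult_right_mono divide_left_mono fact_mono) auto
    also have "\<dots> = \<epsilon> * (\<epsilon> ^ m / fact m * (M (1 + m) * M (1 + m)))"
      by simp
    also have "\<dots> \<le> \<epsilon> * (exp (c * real (1 + 1)) * (pure_moment B n 1 * pure_moment B n 1) *
        (pochhammer (real (1 + 1) + 1) m / fact m * \<eta>' ^ m))"
      using joint_moment_term_le[OF c assms(2), of m 1 1] \<epsilon>_nonneg unfolding \<epsilon>_def M_def \<eta>'_def
      by (intro mult_left_mono) auto
    also have "\<dots> \<le> \<epsilon> * (exp 1 * (4 / B\<^sup>2) ^ n * (pochhammer (real 2 + 1) m / fact m * \<eta>' ^ m))"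
      unfolding \<mu>_1 using c \<epsilon>_nonneg \<eta>'_nonneg
      by (intro mult_left_mono mult_mono) (auto intro!: mult_nonneg_nonneg divide_nonneg_pos pochhammer_nonneg simp: less_imp_le[OF pochhammer_pos])
    finally show ?thesis
      by (simp only: mult.assoc)
  qed
  moreover have "(\<lambda>m. pochhammer (real 2 + 1) m / fact m * \<eta>' ^ m) sums (1 / (1 - \<eta>')) ^ Suc 2"
    using \<eta>'_nonneg \<eta> unfolding \<eta>'_def by (intro sums_pochhammer_geometric) auto
  ultimately have "joint_moment B \<kappa> \<beta> h n 0 0 - (M 0)\<^sup>2 \<le> \<epsilon> * exp 1 * (4 / B\<^sup>2) ^ n * (1 / (1 - \<eta>')) ^ Suc 2"
    by (intro sums_le[OF _ tail sums_mult])
  also have "\<dots> \<le> \<epsilon> * exp 1 * (4 / B\<^sup>2) ^ n * 2 ^ Suc 2"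
  proof (intro mult_left_mono power_mono)
    show "1 / (1 - \<eta>') \<le> 2"
      using \<eta> unfolding \<eta>'_def[symmetric] by (simp add: field_simps)
  qed (use \<epsilon>_nonneg \<eta> in \<open>auto simp: \<eta>'_def\<close>)
  also have "\<dots> = B * D * \<beta>\<^sup>2 * q ^ n"
    using B_gt_1 by (simp add: \<epsilon>_def D_def q_def power_mult_distrib power_divide)
  finally show ?thesis
    by (simp add: M_def)
qed

text \<open>Accumulated cost of the generations below \<open>n\<close>: each passage to the next one
  multiplies the \<open>k\<close>-th moment bound by the exponential of \<open>4 * k\<close> times
  its interaction strength.\<close>

definition c_up :: "real \<Rightarrow> nat \<Rightarrow> real"
  where "c_up \<beta> n = 4 * A * \<beta>\<^sup>2 * (\<Sum>i<n. \<rho> ^ i)"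

lemma c_up_le: "c_up \<beta> n \<le> 4 * A / (1 - \<rho>) * \<beta>\<^sup>2"
proof -
  have "4 * A * \<beta>\<^sup>2 * (\<Sum>i<n. \<rho> ^ i) \<le> 4 * A * \<beta>\<^sup>2 * (1 / (1 - \<rho>))"
    using \<rho>_bounds A_pos by (intro mult_left_mono sum_power_le) auto
  then show ?thesis
    by (simp add: c_up_def mult_ac)
qed

context
  fixes \<beta> h :: real
  assumes \<beta>_small: "8 * A * \<beta>\<^sup>2 \<le> 1 - \<rho>"
begin

lemma c_up_le_half: "c_up \<beta> n \<le> 1 / 2"
proof -
  have "4 * A / (1 - \<rho>) * \<beta>\<^sup>2 \<le> 1 / 2"
    using \<beta>_small \<rho>_bounds by (simp add: field_simps)
  then show ?thesis
    using c_up_le by (rule order_trans[rotated])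
qed

lemma \<eta>_le_half: "A * \<beta>\<^sup>2 * \<rho> ^ n \<le> 1 / 2"
proof -
  have "A * \<beta>\<^sup>2 * \<rho> ^ n \<le> A * \<beta>\<^sup>2 * 1"
    using A_pos \<rho>_bounds by (intro mult_left_mono) (auto simp: power_le_one)
  then show ?thesis
    using \<beta>_small \<rho>_bounds by linarith
qed

lemma moment_le:
  assumes "\<And>i. i \<le> n \<Longrightarrow> moment B \<kappa> \<beta> h i 0 \<le> 1"
  shows "moment B \<kappa> \<beta> h n k \<le> exp (c_up \<beta> n * k) * pure_moment B n k"
  using assms
proof (induction n arbitrary: k)
  case 0
  then show ?case
    using "0.prems"[of 0] by (simp add: moment_0 pure_moment_0_left c_up_def)
next
  case (Suc n)
  show ?case
  proof (cases "k = 0")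
    case True
    then show ?thesis
      using Suc.prems[of "Suc n"] by (simp add: pure_moment_0_right)
  next
    case False
    let ?\<eta> = "A * \<beta>\<^sup>2 * \<rho> ^ n" and ?\<mu> = "pure_moment B n"
    have \<eta>_nonneg: "0 \<le> ?\<eta>"
      using A_pos \<rho>_bounds by simp
    have "(1 / (1 - ?\<eta>)) ^ Suc k \<le> exp (2 * ?\<eta>) ^ Suc k"
      using \<eta>_nonneg \<eta>_le_half[of n] by (intro power_mono inverse_one_minus_le_exp) auto
    \<comment> \<open>For \<open>k \<ge> 1\<close> the exponent \<open>Suc k\<close> is at most
      \<open>2 * k\<close>, which makes the cost linear in \<open>k\<close>.\<close>
    also have "\<dots> \<le> exp (2 * ?\<eta>) ^ (2 * k)"
      using False \<eta>_nonneg by (intro power_increasing) auto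
    finally have geom: "(1 / (1 - ?\<eta>)) ^ Suc k \<le> exp (4 * ?\<eta> * k)"
      by (simp flip: exp_of_nat_mult add: mult_ac)
    have "moment B \<kappa> \<beta> h (Suc n) k = 1 / B * (\<Sum>j\<le>k. (k choose j) * joint_moment B \<kappa> \<beta> h n j (k - j))"
      using B_gt_1 False by (simp add: moment_Suc)
    also have "\<dots> \<le> 1 / B * (\<Sum>j\<le>k. (k choose j) *
        (exp (c_up \<beta> (Suc n) * k) * (?\<mu> j * ?\<mu> (k - j))))"
    proof (intro mult_left_mono sum_mono)
      fix j
      assume "j \<in> {..k}"
      have "joint_moment B \<kappa> \<beta> h n j (k - j) \<le>
        exp (c_up \<beta> n * (j + (k - j))) * (1 / (1 - ?\<eta>)) ^ Suc (j + (k - j)) * (?\<mu> j * ?\<mu> (k - j))"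
        using joint_moment_le[OF c_up_le_half Suc.IH, of j "k - j"] Suc.prems \<eta>_le_half[of n] by simp
      also have "\<dots> = exp (c_up \<beta> n * k) * (1 / (1 - ?\<eta>)) ^ Suc k * (?\<mu> j * ?\<mu> (k - j))"
        using \<open>j \<in> {..k}\<close> by simp
      also have "\<dots> \<le> exp (c_up \<beta> n * k) * exp (4 * ?\<eta> * k) * (?\<mu> j * ?\<mu> (k - j))"
        by (intro mult_right_mono mult_left_mono geom mult_nonneg_nonneg pure_moment_nonneg) auto
      also have "exp (c_up \<beta> n * k) * exp (4 * ?\<eta> * k) = exp (c_up \<beta> (Suc n) * k)"
        by (simp add: c_up_def algebra_simps flip: exp_add)
      finally show "joint_moment B \<kappa> \<beta> h n j (k - j) \<le> \<dots> * (?\<mu> j * ?\<mu> (k - j))" .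
    qed (use B_gt_1 in auto)
    also have "\<dots> = exp (c_up \<beta> (Suc n) * k) * pure_moment B (Suc n) k"
      using B_gt_1 False by (simp add: pure_moment_Suc zero_power sum_distrib_left mult_ac)
    finally show ?thesis .
  qed
qed

text \<open>The map \<open>x \<mapsto> (B - 1 + x\<^sup>2) / B\<close> is the recursion without
  interaction, with unstable fixed point 1; the interaction perturbs it by a summable error.\<close>

lemma partition_Suc_le:
  assumes "\<And>i. i \<le> n \<Longrightarrow> moment B \<kappa> \<beta> h i 0 \<le> 1"
  shows "moment B \<kappa> \<beta> h (Suc n) 0 \<le> (B - 1 + (moment B \<kappa> \<beta> h n 0)\<^sup>2) / B + D * \<beta>\<^sup>2 * q ^ n"
proof -
  have "moment B \<kappa> \<beta> h (Suc n) 0 = 1 - 1 / B + 1 / B * joint_moment B \<kappa> \<beta> h n 0 0"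
    using B_gt_1 by (simp add: moment_Suc)
  also have "\<dots> \<le> 1 - 1 / B + 1 / B * ((moment B \<kappa> \<beta> h n 0)\<^sup>2 + B * D * \<beta>\<^sup>2 * q ^ n)"
    using B_gt_1 assms
    by (intro add_left_mono mult_left_mono joint_moment_0_0_le[of "c_up \<beta> n"] c_up_le_half \<eta>_le_half moment_le) auto
  also have "\<dots> = (B - 1 + (moment B \<kappa> \<beta> h n 0)\<^sup>2) / B + D * \<beta>\<^sup>2 * q ^ n"
    using B_gt_1 by (simp add: field_simps)
  finally show ?thesis .
qed

end

section \<open>Free energy and critical point\<close>

text \<open>Each subtree has at most \<open>2 ^ n\<close> leaves, so the product of the two counts
  is at most \<open>2 ^ n\<close> times their sum. Each merge thus adds one term of a geometric
  series in \<open>2 * \<kappa>\<close>.\<close>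

lemma hamiltonian_le_geometric:
  assumes "length w = 2 ^ n"
  shows "annealed_hamiltonian \<kappa> \<beta> h n w \<le> (h + \<beta>\<^sup>2 / 2 * (\<Sum>p\<le>n. (2 * \<kappa>) ^ p)) * leaves n w"
  using assms
proof (induction n arbitrary: w)
  case 0
  then obtain x where "w = [x]"
    by (auto simp: length_Suc_conv)
  then show ?case
    by (simp add: annealed_hamiltonian_def leaves_def delta_def hdist_self)
next
  case (Suc n)
  define v w' where "v = take (2 ^ n) w" and "w' = drop (2 ^ n) w"
  have w: "w = v @ w'" "length v = 2 ^ n" "length w' = 2 ^ n"
    using Suc.prems by (auto simp: v_def w'_def)
  define x y where "x = leaves n v" and "y = leaves n w'"
  have xy: "0 \<le> x" "0 \<le> y" "x \<le> 2 ^ n" "y \<le> 2 ^ n"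
    by (simp_all add: x_def y_def leaves_nonneg leaves_le)
  have "2 * (x * y) \<le> 2 ^ n * (x + y)"
    using mult_right_mono[OF xy(3) xy(2)] mult_right_mono[OF xy(4) xy(1)] by (simp add: algebra_simps)
  then have "2 * (x * y) \<le> 2 * (2 ^ n * (x + y))"
    using xy by (smt (verit) mult_nonneg_nonneg zero_le_power)
  then have "\<beta>\<^sup>2 * \<kappa> ^ Suc n * (x * y) \<le> \<beta>\<^sup>2 * \<kappa> ^ Suc n * (2 ^ n * (x + y))"
    using \<kappa>_pos by (intro mult_left_mono) auto
  also have "\<dots> = \<beta>\<^sup>2 / 2 * (2 * \<kappa>) ^ Suc n * (x + y)"
    by (simp add: power_mult_distrib)
  finally have "\<beta>\<^sup>2 * \<kappa> ^ Suc n * x * y \<le> \<beta>\<^sup>2 / 2 * (2 * \<kappa>) ^ Suc n * (x + y)"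
    by (simp only: mult.assoc)
  moreover have "annealed_hamiltonian \<kappa> \<beta> h n v \<le> (h + \<beta>\<^sup>2 / 2 * (\<Sum>p\<le>n. (2 * \<kappa>) ^ p)) * x"
    "annealed_hamiltonian \<kappa> \<beta> h n w' \<le> (h + \<beta>\<^sup>2 / 2 * (\<Sum>p\<le>n. (2 * \<kappa>) ^ p)) * y"
    using Suc.IH w unfolding x_def y_def by auto
  moreover have "(h + \<beta>\<^sup>2 / 2 * (\<Sum>p\<le>Suc n. (2 * \<kappa>) ^ p)) * (x + y) =
    (h + \<beta>\<^sup>2 / 2 * (\<Sum>p\<le>n. (2 * \<kappa>) ^ p)) * x + (h + \<beta>\<^sup>2 / 2 * (\<Sum>p\<le>n. (2 * \<kappa>) ^ p)) * y +
    \<beta>\<^sup>2 / 2 * (2 * \<kappa>) ^ Suc n * (x + y)"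
    unfolding sum.atMost_Suc by (simp only: distrib_left distrib_right add_ac)
  ultimately show ?case
    unfolding w(1) annealed_hamiltonian_append[OF w(2)] leaves_append[OF w(2)] x_def[symmetric] y_def[symmetric]
    by linarith
qed

lemma hamiltonian_le:
  assumes "length w = 2 ^ n"
  shows "annealed_hamiltonian \<kappa> \<beta> h n w \<le> (h + \<beta>\<^sup>2 / (1 - 2 * \<kappa>)) * leaves n w"
proof -
  have "\<beta>\<^sup>2 / 2 * (\<Sum>p\<le>n. (2 * \<kappa>) ^ p) \<le> \<beta>\<^sup>2 * (1 / (1 - 2 * \<kappa>))"
    using \<kappa>_pos \<kappa>_less_half sum_power_le[of "2 * \<kappa>" "Suc n"]
    by (intro mult_mono) (auto simp: lessThan_Suc_atMost intro!: sum_nonneg)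
  then have "(h + \<beta>\<^sup>2 / 2 * (\<Sum>p\<le>n. (2 * \<kappa>) ^ p)) * leaves n w \<le> (h + \<beta>\<^sup>2 / (1 - 2 * \<kappa>)) * leaves n w"
    by (intro mult_right_mono leaves_nonneg) simp
  then show ?thesis
    using hamiltonian_le_geometric[OF assms] by (rule order_trans[rotated])
qed

lemma partition_ge:
  "(B - 1 + (moment B \<kappa> \<beta> h n 0)\<^sup>2) / B \<le> moment B \<kappa> \<beta> h (Suc n) 0"
proof -
  have "1 / B * (moment B \<kappa> \<beta> h n 0)\<^sup>2 \<le> 1 / B * joint_moment B \<kappa> \<beta> h n 0 0"
    using joint_moment_ge[of \<kappa> B \<beta> h n 0 0] \<kappa>_pos B_gt_1
    by (intro mult_left_mono) (auto simp: power2_eq_square)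
  then show ?thesis
    using B_gt_1 by (simp add: moment_Suc diff_divide_distrib add_divide_distrib)
qed

lemma partition_pos: "0 < moment B \<kappa> \<beta> h n 0"
proof (cases n)
  case (Suc m)
  have "0 < (B - 1 + (moment B \<kappa> \<beta> h m 0)\<^sup>2) / B"
    using B_gt_1 by (intro divide_pos_pos add_pos_nonneg) auto
  then show ?thesis
    using partition_ge[of \<beta> h m] Suc by simp
qed (simp add: moment_0)

lemma partition_le: "moment B \<kappa> \<beta> h n 0 \<le> exp (\<bar>h + \<beta>\<^sup>2 / (1 - 2 * \<kappa>)\<bar> * 2 ^ n)"
proof -
  have "moment B \<kappa> \<beta> h n 0 \<le> measure_pmf.expectation (GW_law B n) (\<lambda>_. exp (\<bar>h + \<beta>\<^sup>2 / (1 - 2 * \<kappa>)\<bar> * 2 ^ n))"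
    unfolding moment_def
  proof (rule expectation_GW_law_mono)
    fix w :: "bool list"
    assume "length w = 2 ^ n"
    then have "annealed_hamiltonian \<kappa> \<beta> h n w \<le> (h + \<beta>\<^sup>2 / (1 - 2 * \<kappa>)) * leaves n w"
      by (rule hamiltonian_le)
    also have "\<dots> \<le> \<bar>h + \<beta>\<^sup>2 / (1 - 2 * \<kappa>)\<bar> * 2 ^ n"
      by (intro mult_mono leaves_le leaves_nonneg) auto
    finally show "leaves n w ^ 0 * exp (annealed_hamiltonian \<kappa> \<beta> h n w) \<le> exp (\<bar>h + \<beta>\<^sup>2 / (1 - 2 * \<kappa>)\<bar> * 2 ^ n)"
      by simp
  qed
  then show ?thesis
    by simp
qed

text \<open>Dividing by \<open>B\<close> turns the lower recursion into exact squaring, so this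
  sequence is monotone; the correction \<open>ln B / 2 ^ n\<close> vanishes in the limit.\<close>

definition L :: "real \<Rightarrow> real \<Rightarrow> nat \<Rightarrow> real"
  where "L \<beta> h n = ln (moment B \<kappa> \<beta> h n 0 / B) / 2 ^ n"

lemma incseq_L: "incseq (L \<beta> h)"
proof (rule incseq_SucI)
  fix n
  let ?Z = "\<lambda>n. moment B \<kappa> \<beta> h n 0"
  have "(?Z n / B)\<^sup>2 \<le> ?Z (Suc n) / B"
  proof -
    have "(?Z n)\<^sup>2 / B \<le> (B - 1 + (?Z n)\<^sup>2) / B"
      using B_gt_1 by (intro divide_right_mono) auto
    also have "\<dots> \<le> ?Z (Suc n)"
      by (rule partition_ge)
    finally show ?thesis
      using B_gt_1 by (simp add: power2_eq_square field_simps)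
  qed
  then have "ln ((?Z n / B)\<^sup>2) \<le> ln (?Z (Suc n) / B)"
    using B_gt_1 partition_pos[of \<beta> h n] by (intro ln_mono) auto
  also have "ln ((?Z n / B)\<^sup>2) = 2 * ln (?Z n / B)"
    using B_gt_1 partition_pos[of \<beta> h n] ln_realpow[of "?Z n / B" 2] by simp
  finally show "L \<beta> h n \<le> L \<beta> h (Suc n)"
    by (simp add: L_def field_simps)
qed

lemma L_LIMSEQ: "L \<beta> h \<longlonglongrightarrow> annealed_free_energy B \<kappa> \<beta> h"
  and free_energy_LIMSEQ: "(\<lambda>n. ln (moment B \<kappa> \<beta> h n 0) / 2 ^ n) \<longlonglongrightarrow> annealed_free_energy B \<kappa> \<beta> h"
proof -
  let ?c = "\<bar>h + \<beta>\<^sup>2 / (1 - 2 * \<kappa>)\<bar>"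
  have le: "L \<beta> h n \<le> ?c" for n
  proof -
    have "moment B \<kappa> \<beta> h n 0 / B \<le> moment B \<kappa> \<beta> h n 0 / 1"
      using B_gt_1 moment_nonneg[of B \<kappa> \<beta> h n 0] by (intro divide_left_mono) auto
    also have "\<dots> \<le> exp (?c * 2 ^ n)"
      using partition_le by simp
    finally have "ln (moment B \<kappa> \<beta> h n 0 / B) \<le> ?c * 2 ^ n"
      using partition_pos[of \<beta> h n] B_gt_1 ln_mono[of "moment B \<kappa> \<beta> h n 0 / B" "exp (?c * 2 ^ n)"] by simp
    then show ?thesis
      by (simp add: L_def field_simps)
  qed
  obtain l where l: "L \<beta> h \<longlonglongrightarrow> l"
    using incseq_convergent[OF incseq_L, of \<beta> h ?c] le by blast
  have "(\<lambda>n. ln B * (1 / 2) ^ n) \<longlonglongrightarrow> ln B * 0"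
    by (intro tendsto_intros LIMSEQ_power_zero) auto
  from tendsto_add[OF l this] have "(\<lambda>n. ln (moment B \<kappa> \<beta> h n 0) / 2 ^ n) \<longlonglongrightarrow> l"
    using B_gt_1 by (simp add: L_def less_imp_not_eq2[OF partition_pos] ln_div power_one_over diff_divide_distrib)
  moreover from this have "annealed_free_energy B \<kappa> \<beta> h = l"
    unfolding annealed_free_energy_def annealed_partition_eq_moment by (rule limI)
  ultimately show "L \<beta> h \<longlonglongrightarrow> annealed_free_energy B \<kappa> \<beta> h"
    "(\<lambda>n. ln (moment B \<kappa> \<beta> h n 0) / 2 ^ n) \<longlonglongrightarrow> annealed_free_energy B \<kappa> \<beta> h"
    using l by simp_all
qed

text \<open>The lower recursion has slope \<open>2 / B > 1\<close> at its fixed point 1 and is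
  convex, so any excess over 1 grows geometrically. Beyond \<open>B\<close> the sequence
  \<open>L\<close> is positive.\<close>

lemma partition_exceeds:
  assumes "1 < moment B \<kappa> \<beta> h n 0"
  shows "\<exists>m. B < moment B \<kappa> \<beta> h m 0"
proof -
  let ?Z = "\<lambda>n. moment B \<kappa> \<beta> h n 0"
  have growth: "(2 / B) ^ l * (?Z n - 1) \<le> ?Z (n + l) - 1" for l
  proof (induction l)
    case (Suc l)
    have "(2 / B) ^ Suc l * (?Z n - 1) \<le> 2 / B * (?Z (n + l) - 1)"
      using mult_left_mono[OF Suc.IH, of "2 / B"] B_gt_1 by (simp add: mult.assoc)
    also have "\<dots> \<le> (B - 1 + (?Z (n + l))\<^sup>2) / B - 1"
    proof -
      have "2 * (?Z (n + l) - 1) / B \<le> ((?Z (n + l))\<^sup>2 - 1) / B"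
        using B_gt_1 zero_le_power2[of "?Z (n + l) - 1"] by (intro divide_right_mono) (auto simp: power2_diff)
      then show ?thesis
        using B_gt_1 by (simp add: diff_divide_distrib add_divide_distrib)
    qed
    also have "\<dots> \<le> ?Z (n + Suc l) - 1"
      using partition_ge[of \<beta> h "n + l"] by simp
    finally show ?case .
  qed simp
  obtain l where "(B - 1) / (?Z n - 1) < (2 / B) ^ l"
    using B_gt_1 B_less_2 real_arch_pow[of "2 / B"] by auto
  then have "B - 1 < (2 / B) ^ l * (?Z n - 1)"
    using assms by (simp add: field_simps)
  then show ?thesis
    using growth[of l] by (intro exI[of _ "n + l"]) linarith
qed

lemma free_energy_eq_0_iff: "annealed_free_energy B \<kappa> \<beta> h = 0 \<longleftrightarrow> (\<forall>n. moment B \<kappa> \<beta> h n 0 \<le> 1)"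
proof
  assume F: "annealed_free_energy B \<kappa> \<beta> h = 0"
  show "\<forall>n. moment B \<kappa> \<beta> h n 0 \<le> 1"
  proof (rule ccontr)
    assume "\<not> (\<forall>n. moment B \<kappa> \<beta> h n 0 \<le> 1)"
    then obtain n where "1 < moment B \<kappa> \<beta> h n 0"
      by (auto simp: not_le)
    then obtain m where "B < moment B \<kappa> \<beta> h m 0"
      using partition_exceeds by blast
    then have "0 < L \<beta> h m"
      using B_gt_1 by (simp add: L_def)
    moreover have "L \<beta> h m \<le> annealed_free_energy B \<kappa> \<beta> h"
      by (rule incseq_le[OF incseq_L L_LIMSEQ])
    ultimately show False
      using F by simp
  qed
next
  assume *: "\<forall>n. moment B \<kappa> \<beta> h n 0 \<le> 1"
  have "ln (moment B \<kappa> \<beta> h n 0) / 2 ^ n \<le> 0" for n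
    using * partition_pos[of \<beta> h n] by (simp add: divide_le_0_iff)
  then have "annealed_free_energy B \<kappa> \<beta> h \<le> 0"
    by (intro LIMSEQ_le_const2[OF free_energy_LIMSEQ]) auto
  \<comment> \<open>The sequence is shifted by one: the barren root guarantees a partition function
    of at least \<open>(B - 1) / B\<close> only from generation 1 on.\<close>
  moreover have "0 \<le> annealed_free_energy B \<kappa> \<beta> h"
  proof (rule LIMSEQ_le[OF _ LIMSEQ_Suc[OF free_energy_LIMSEQ]])
    have "(\<lambda>n. ln ((B - 1) / B) * (1 / 2) ^ n) \<longlonglongrightarrow> ln ((B - 1) / B) * 0"
      by (intro tendsto_intros LIMSEQ_power_zero) auto
    from LIMSEQ_Suc[OF this] show "(\<lambda>n. ln ((B - 1) / B) / 2 ^ Suc n) \<longlonglongrightarrow> 0"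
      by (simp add: power_one_over)
    have "ln ((B - 1) / B) / 2 ^ Suc n \<le> ln (moment B \<kappa> \<beta> h (Suc n) 0) / 2 ^ Suc n" for n
    proof (intro divide_right_mono ln_mono)
      have "(B - 1) / B \<le> (B - 1 + (moment B \<kappa> \<beta> h n 0)\<^sup>2) / B"
        using B_gt_1 by (intro divide_right_mono) auto
      then show "(B - 1) / B \<le> moment B \<kappa> \<beta> h (Suc n) 0"
        using partition_ge by (rule order_trans)
    qed (use B_gt_1 in auto)
    then show "\<exists>N. \<forall>n\<ge>N. ln ((B - 1) / B) / 2 ^ Suc n \<le> ln (moment B \<kappa> \<beta> h (Suc n) 0) / 2 ^ Suc n"
      by blast
  qed
  ultimately show "annealed_free_energy B \<kappa> \<beta> h = 0"
    by simp
qed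

section \<open>Continuity in \<open>h\<close> and the critical point\<close>

lemma continuous_partition: "continuous_on UNIV (\<lambda>h. moment B \<kappa> \<beta> h n 0)"
  unfolding moment_def expectation_GW_law_eq_sum annealed_hamiltonian_def
  by (intro continuous_intros)

abbreviation h_c :: "real \<Rightarrow> real"
  where "h_c \<equiv> annealed_critical_point B \<kappa>"

lemma bdd_above_subcritical: "bdd_above {h. annealed_free_energy B \<kappa> \<beta> h = 0}"
proof (rule bdd_aboveI[of _ 0])
  fix h
  assume "h \<in> {h. annealed_free_energy B \<kappa> \<beta> h = 0}"
  then have "moment B \<kappa> \<beta> h 0 0 \<le> 1"
    by (simp add: free_energy_eq_0_iff)
  moreover have "0 \<le> \<beta>\<^sup>2"
    by simp
  ultimately show "h \<le> 0"
    unfolding moment_0 exp_le_one_iff by linarith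
qed

text \<open>The set of \<open>h\<close> with zero free energy is closed, being cut out by closed
  conditions, so it contains its supremum.\<close>

lemma critical_partition_le: "moment B \<kappa> \<beta> (h_c \<beta>) n 0 \<le> 1"
proof -
  let ?G = "{h. annealed_free_energy B \<kappa> \<beta> h = 0}"
  have "?G = (\<Inter>n. {h. moment B \<kappa> \<beta> h n 0 \<le> 1})"
    by (auto simp: free_energy_eq_0_iff)
  then have "closed ?G"
    by (simp add: closed_INT closed_Collect_le continuous_partition)
  \<comment> \<open>At this value the upper bound on the Hamiltonian vanishes, so the set is
    nonempty.\<close>
  moreover have "- \<beta>\<^sup>2 / (1 - 2 * \<kappa>) \<in> ?G"
  proof -
    have "moment B \<kappa> \<beta> (- \<beta>\<^sup>2 / (1 - 2 * \<kappa>)) n 0 \<le> measure_pmf.expectation (GW_law B n) (\<lambda>_. 1)" for n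
      unfolding moment_def
      using hamiltonian_le[of _ n \<beta> "- \<beta>\<^sup>2 / (1 - 2 * \<kappa>)"] by (intro expectation_GW_law_mono) simp
    then show ?thesis
      by (simp add: free_energy_eq_0_iff)
  qed
  ultimately have "h_c \<beta> \<in> ?G"
    unfolding annealed_critical_point_def using bdd_above_subcritical[of \<beta>]
    by (intro closed_contains_Sup) auto
  then show ?thesis
    by (simp add: free_energy_eq_0_iff)
qed

lemma supercritical_partition_gt:
  assumes "h_c \<beta> < h"
  shows "\<exists>n. 1 < moment B \<kappa> \<beta> h n 0"
proof (rule ccontr)
  assume "\<not> ?thesis"
  then have "h \<in> {h. annealed_free_energy B \<kappa> \<beta> h = 0}"
    by (auto simp: free_energy_eq_0_iff not_less)
  then have "h \<le> h_c \<beta>"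
    unfolding annealed_critical_point_def by (rule cSup_upper[OF _ bdd_above_subcritical])
  then show False
    using assms by simp
qed

section \<open>The partition function at criticality\<close>

text \<open>Chosen so that half of the linear gain \<open>2 / B - 1\<close> of a deficit of this
  size pays exactly for the error \<open>D * \<beta>\<^sup>2 * q ^ n\<close>.\<close>

definition deficit_const :: real
  where "deficit_const = 2 * D / (2 / B - 1)"

lemma deficit_const_pos: "0 < deficit_const"
  using D_pos B_gt_1 B_less_2 by (simp add: deficit_const_def field_simps)

context
  fixes \<beta> :: real
  assumes \<beta>_small: "8 * A * \<beta>\<^sup>2 \<le> 1 - \<rho>" "deficit_const * \<beta>\<^sup>2 \<le> (2 - B) / 2"
begin

lemma deficit_bounds: "0 \<le> deficit_const * \<beta>\<^sup>2 * q ^ n" "deficit_const * \<beta>\<^sup>2 * q ^ n \<le> (2 - B) / 2"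
proof -
  have "deficit_const * \<beta>\<^sup>2 * q ^ n \<le> deficit_const * \<beta>\<^sup>2 * 1"
    using deficit_const_pos q_bounds by (intro mult_left_mono) (auto simp: power_le_one)
  then show "deficit_const * \<beta>\<^sup>2 * q ^ n \<le> (2 - B) / 2"
    using \<beta>_small by simp
qed (use deficit_const_pos q_bounds in simp)

text \<open>A deficit \<open>1 - Z\<close> is expanded by the factor \<open>2 / B > 1\<close>, which beats the error \<open>D * \<beta>\<^sup>2 * q ^ n\<close>
  once the deficit exceeds \<open>deficit_const * \<beta>\<^sup>2 * q ^ n\<close>.\<close>

lemma partition_Suc_deficit:
  assumes le: "\<And>i. i \<le> n \<Longrightarrow> moment B \<kappa> \<beta> h i 0 \<le> 1"
    and deficit: "moment B \<kappa> \<beta> h n 0 \<le> 1 - deficit_const * \<beta>\<^sup>2 * q ^ n"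
  shows "moment B \<kappa> \<beta> h (Suc n) 0 \<le> 1 - deficit_const * \<beta>\<^sup>2 * q ^ Suc n"
proof -
  define Z y where "Z = moment B \<kappa> \<beta> h n 0" and "y = deficit_const * \<beta>\<^sup>2 * q ^ n"
  have y: "0 \<le> y" "y \<le> (2 - B) / 2"
    unfolding y_def by (fact deficit_bounds)+
  have "Z\<^sup>2 \<le> (1 - y)\<^sup>2"
    using deficit moment_nonneg[of B \<kappa> \<beta> h n 0] by (intro power_mono) (auto simp: Z_def y_def)
  \<comment> \<open>The quadratic term is absorbed through \<open>y \<le> (2 - B) / 2\<close>, at
    the cost of the other half of the gain.\<close>
  also have "(1 - y)\<^sup>2 \<le> 1 - y * (1 + B / 2)"
    using mult_left_mono[OF y(2) y(1)] by (simp add: power2_eq_square field_simps)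
  finally have "(B - 1 + Z\<^sup>2) / B \<le> (B - y * (1 + B / 2)) / B"
    using B_gt_1 by (intro divide_right_mono) auto
  also have "\<dots> = 1 - y - y * (2 / B - 1) / 2"
    using B_gt_1 by (simp add: field_simps)
  also have "y * (2 / B - 1) / 2 = D * \<beta>\<^sup>2 * q ^ n"
    using B_gt_1 B_less_2 by (simp add: y_def deficit_const_def)
  finally have "moment B \<kappa> \<beta> h (Suc n) 0 \<le> 1 - y"
    using partition_Suc_le[OF \<beta>_small(1) le] by (fastforce simp: Z_def)
  also have "\<dots> \<le> 1 - deficit_const * \<beta>\<^sup>2 * q ^ Suc n"
    using q_bounds mult_left_mono[of q 1 y] y by (simp add: y_def mult_ac)
  finally show ?thesis .
qed

lemma partition_stays_deficient:
  assumes le: "\<And>i. i \<le> n \<Longrightarrow> moment B \<kappa> \<beta> h i 0 \<le> 1"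
    and deficit: "moment B \<kappa> \<beta> h n 0 \<le> 1 - deficit_const * \<beta>\<^sup>2 * q ^ n"
  shows "(\<forall>i\<le>n + l. moment B \<kappa> \<beta> h i 0 \<le> 1) \<and> moment B \<kappa> \<beta> h (n + l) 0 \<le> 1 - deficit_const * \<beta>\<^sup>2 * q ^ (n + l)"
proof (induction l)
  case (Suc l)
  then have "moment B \<kappa> \<beta> h (Suc (n + l)) 0 \<le> 1 - deficit_const * \<beta>\<^sup>2 * q ^ Suc (n + l)"
    by (intro partition_Suc_deficit) auto
  then show ?case
    using Suc deficit_bounds(1)[of "Suc (n + l)"] by (auto simp: le_Suc_eq)
qed (use assms in auto)

lemma partition_ge_1_mono:
  assumes "1 \<le> moment B \<kappa> \<beta> h i 0" "i \<le> n"
  shows "1 \<le> moment B \<kappa> \<beta> h n 0"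
  using assms(2)
proof (induction rule: dec_induct)
  case (step n)
  have "1 \<le> (B - 1 + (moment B \<kappa> \<beta> h n 0)\<^sup>2) / B"
    using B_gt_1 one_le_power[OF step.IH, of 2] by simp
  then show ?case
    using partition_ge by (rule order_trans)
qed (use assms in simp)

lemma critical_partition_ge: "1 - deficit_const * \<beta>\<^sup>2 * q ^ n \<le> moment B \<kappa> \<beta> (h_c \<beta>) n 0"
proof (rule ccontr)
  assume "\<not> ?thesis"
  then have "moment B \<kappa> \<beta> (h_c \<beta>) n 0 < 1 - deficit_const * \<beta>\<^sup>2 * q ^ n"
    by simp
  \<comment> \<open>Continuity carries the strict deficit over to some \<open>h\<close> just above
    the critical point.\<close>
  moreover have "((\<lambda>h. moment B \<kappa> \<beta> h n 0) \<longlongrightarrow> moment B \<kappa> \<beta> (h_c \<beta>) n 0) (at_right (h_c \<beta>))"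
    using continuous_partition[of \<beta> n] by (auto simp: continuous_on_def intro: tendsto_within_subset)
  ultimately have "\<forall>\<^sub>F h in at_right (h_c \<beta>). moment B \<kappa> \<beta> h n 0 < 1 - deficit_const * \<beta>\<^sup>2 * q ^ n \<and> h_c \<beta> < h"
    by (intro eventually_conj order_tendstoD eventually_at_right_less)
  then obtain h where h: "moment B \<kappa> \<beta> h n 0 < 1 - deficit_const * \<beta>\<^sup>2 * q ^ n" "h_c \<beta> < h"
    using eventually_happens' trivial_limit_at_right_real by blast
  \<comment> \<open>Once at least 1, the partition function stays so; the deficit at
    \<open>n\<close> therefore forces all earlier values below 1.\<close>
  have "moment B \<kappa> \<beta> h i 0 \<le> 1" if "i \<le> n" for i
    using partition_ge_1_mono[of h i n] that h(1) deficit_bounds(1)[of n] by linarith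
  then have "moment B \<kappa> \<beta> h m 0 \<le> 1" for m
    using partition_stays_deficient[of n h m] h(1) by (auto simp: less_imp_le)
  then show False
    using supercritical_partition_gt[OF h(2)] by (auto simp: not_le[symmetric])
qed

text \<open>The leading 1 pays for the deficit at generation 0 and the sum for each later step; the
  factor 2 comes from \<open>exp (- (2 * y)) \<le> 1 - y\<close>.\<close>

definition c_low :: "nat \<Rightarrow> real"
  where "c_low n = 2 * deficit_const * \<beta>\<^sup>2 * (1 + (\<Sum>i<n. q ^ i))"

lemma c_low_le: "c_low n \<le> 2 * deficit_const * (1 + 1 / (1 - q)) * \<beta>\<^sup>2"
proof -
  have "c_low n \<le> 2 * deficit_const * \<beta>\<^sup>2 * (1 + 1 / (1 - q))"
    unfolding c_low_def using deficit_const_pos q_bounds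
    by (intro mult_left_mono add_left_mono sum_power_le) auto
  then show ?thesis
    by (simp only: mult_ac)
qed

lemma exp_deficit_le: "exp (- (2 * (deficit_const * \<beta>\<^sup>2 * q ^ n))) \<le> 1 - deficit_const * \<beta>\<^sup>2 * q ^ n"
proof -
  have "deficit_const * \<beta>\<^sup>2 * q ^ n \<le> 1 / 2"
    using B_gt_1 by (intro order_trans[OF deficit_bounds(2)]) simp
  then show ?thesis
    using inverse_one_minus_le_exp[OF deficit_bounds(1)[of n]] by (simp add: exp_minus field_simps)
qed

lemma critical_moment_ge:
  assumes "k \<noteq> 0"
  shows "exp (- (c_low n * k)) * pure_moment B n k \<le> moment B \<kappa> \<beta> (h_c \<beta>) n k"
  using assms
proof (induction n arbitrary: k)
  case 0
  have "exp (- (c_low 0 * k)) \<le> exp (- (2 * (deficit_const * \<beta>\<^sup>2 * q ^ 0)))"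
    using 0 mult_left_mono[of 1 "real k" "deficit_const * \<beta>\<^sup>2"] deficit_const_pos by (simp add: c_low_def mult_ac)
  also have "\<dots> \<le> 1 - deficit_const * \<beta>\<^sup>2 * q ^ 0"
    by (rule exp_deficit_le)
  also have "\<dots> \<le> moment B \<kappa> \<beta> (h_c \<beta>) 0 0"
    by (rule critical_partition_ge)
  finally show ?case
    by (simp add: moment_0 pure_moment_0_left)
next
  case (Suc n)
  define y where "y = deficit_const * \<beta>\<^sup>2 * q ^ n"
  let ?\<mu> = "pure_moment B n" and ?M = "moment B \<kappa> \<beta> (h_c \<beta>) n" and ?c = "c_low n"
  have y: "0 \<le> y" "y \<le> 1 / 2"
    using deficit_bounds[of n] B_gt_1 by (auto simp: y_def)
  have M_0: "1 - y \<le> ?M 0"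
    unfolding y_def by (rule critical_partition_ge)
  have "exp (- (2 * y * k)) \<le> exp (- (2 * y))"
    using Suc.prems y mult_left_mono[of 1 "real k" y] by (simp add: mult_ac)
  also have "\<dots> \<le> 1 - y"
    unfolding y_def by (rule exp_deficit_le)
  finally have exp_le: "exp (- (2 * y * k)) \<le> 1 - y" .
  have step: "exp (- (c_low (Suc n) * k)) * (?\<mu> j * ?\<mu> (k - j)) \<le> joint_moment B \<kappa> \<beta> (h_c \<beta>) n j (k - j)"
    if "j \<le> k" for j
  proof -
    have "exp (- (c_low (Suc n) * k)) = exp (- (?c * k)) * exp (- (2 * y * k))"
      by (simp add: c_low_def y_def algebra_simps flip: exp_add)
    then have "exp (- (c_low (Suc n) * k)) * (?\<mu> j * ?\<mu> (k - j)) \<le>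
      exp (- (?c * k)) * (1 - y) * (?\<mu> j * ?\<mu> (k - j))"
      using exp_le by (auto intro!: mult_right_mono mult_nonneg_nonneg pure_moment_nonneg)
    also have "\<dots> \<le> ?M j * ?M (k - j)"
    proof -
      \<comment> \<open>If \<open>j\<close> is 0 or \<open>k\<close>, one factor is the partition
        function, bounded below by \<open>1 - y\<close>, and the induction hypothesis covers the
        other. Otherwise it covers both, and \<open>1 - y \<le> 1\<close> is discarded.\<close>
      consider "j = 0" | "j = k" | "j \<noteq> 0" "k - j \<noteq> 0"
        using \<open>j \<le> k\<close> by linarith
      then show ?thesis
      proof cases
        case 1
        have "(1 - y) * (exp (- (?c * k)) * ?\<mu> k) \<le> ?M 0 * ?M k"
          using y Suc.IH Suc.prems by (intro mult_mono M_0 moment_nonneg mult_nonneg_nonneg pure_moment_nonneg) auto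
        then show ?thesis
          using 1 by (simp add: pure_moment_0_right mult_ac)
      next
        case 2
        have "(exp (- (?c * k)) * ?\<mu> k) * (1 - y) \<le> ?M k * ?M 0"
          using y Suc.IH Suc.prems by (intro mult_mono M_0 moment_nonneg mult_nonneg_nonneg pure_moment_nonneg) auto
        then show ?thesis
          using 2 by (simp add: pure_moment_0_right mult_ac)
      next
        case 3
        have "exp (- (?c * k)) * (1 - y) * (?\<mu> j * ?\<mu> (k - j)) \<le> exp (- (?c * k)) * 1 * (?\<mu> j * ?\<mu> (k - j))"
          using y by (intro mult_right_mono mult_left_mono mult_nonneg_nonneg pure_moment_nonneg) auto
        also have "\<dots> = (exp (- (?c * j)) * ?\<mu> j) * (exp (- (?c * (k - j))) * ?\<mu> (k - j))"
          using \<open>j \<le> k\<close> by (simp add: of_nat_diff algebra_simps flip: exp_add)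
        also have "\<dots> \<le> ?M j * ?M (k - j)"
          using 3 by (intro mult_mono Suc.IH moment_nonneg mult_nonneg_nonneg pure_moment_nonneg) auto
        finally show ?thesis .
      qed
    qed
    also have "\<dots> \<le> joint_moment B \<kappa> \<beta> (h_c \<beta>) n j (k - j)"
      using \<kappa>_pos by (intro joint_moment_ge) simp
    finally show ?thesis .
  qed
  have "exp (- (c_low (Suc n) * k)) * pure_moment B (Suc n) k =
    1 / B * (\<Sum>j\<le>k. (k choose j) * (exp (- (c_low (Suc n) * k)) * (?\<mu> j * ?\<mu> (k - j))))"
    using B_gt_1 Suc.prems by (simp add: pure_moment_Suc zero_power sum_distrib_left mult_ac)
  also have "\<dots> \<le> 1 / B * (\<Sum>j\<le>k. (k choose j) * joint_moment B \<kappa> \<beta> (h_c \<beta>) n j (k - j))"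
    using B_gt_1 by (intro mult_left_mono sum_mono step) auto
  also have "\<dots> = moment B \<kappa> \<beta> (h_c \<beta>) (Suc n) k"
    using B_gt_1 Suc.prems by (simp add: moment_Suc zero_power)
  finally show ?case .
qed

end

section \<open>Laplace transforms\<close>

abbreviation pure_laplace :: "nat \<Rightarrow> real \<Rightarrow> real"
  where "pure_laplace n u \<equiv> measure_pmf.expectation (GW_law B n) (\<lambda>w. exp (u * leaves n w))"

abbreviation critical_laplace :: "real \<Rightarrow> nat \<Rightarrow> real \<Rightarrow> real"
  where "critical_laplace \<beta> n u \<equiv> measure_pmf.expectation (GW_law B n)
    (\<lambda>w. exp (u * leaves n w) * exp (annealed_hamiltonian \<kappa> \<beta> (h_c \<beta>) n w))"

lemma pure_laplace_mono: "u \<le> v \<Longrightarrow> pure_laplace n u \<le> pure_laplace n v"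
  by (intro expectation_GW_law_mono) (simp add: leaves_nonneg mult_right_mono)

lemma pure_laplace_ge_1:
  assumes "0 \<le> u"
  shows "1 \<le> pure_laplace n u"
  using pure_laplace_mono[OF assms, of n] by simp

text \<open>Tilting by \<open>exp (u * S)\<close> shifts the field \<open>h\<close> by
  \<open>u\<close>, which links the Laplace transform to the free energy.\<close>

lemma critical_laplace_eq: "critical_laplace \<beta> n u = moment B \<kappa> \<beta> (h_c \<beta> + u) n 0"
  unfolding moment_def annealed_hamiltonian_def by (simp add: algebra_simps flip: exp_add)

lemma pure_laplace_eq: "pure_laplace n u = moment B \<kappa> 0 u n 0"
  unfolding moment_def annealed_hamiltonian_def by simp

lemma pure_free_energy_LIMSEQ: "(\<lambda>n. ln (pure_laplace n u) / 2 ^ n) \<longlonglongrightarrow> pure_free_energy B u"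
proof -
  have "(\<lambda>n. ln (pure_laplace n u) / 2 ^ n) \<longlonglongrightarrow> annealed_free_energy B \<kappa> 0 u"
    unfolding pure_laplace_eq by (rule free_energy_LIMSEQ)
  moreover from this have "pure_free_energy B u = annealed_free_energy B \<kappa> 0 u"
    unfolding pure_free_energy_def by (rule limI)
  ultimately show ?thesis
    by simp
qed

text \<open>A factor \<open>exp (c * \<beta>\<^sup>2) ^ k\<close> on the \<open>k\<close>-th moment
  is a rescaling of \<open>u\<close>, so the moment bounds compare the exponential series
  termwise.\<close>

lemma critical_laplace_le:
  assumes \<beta>_small: "8 * A * \<beta>\<^sup>2 \<le> 1 - \<rho>" and c: "4 * A / (1 - \<rho>) \<le> c" and "0 \<le> u"
  shows "critical_laplace \<beta> n u \<le> pure_laplace n (exp (c * \<beta>\<^sup>2) * u)"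
proof (rule sums_le[OF _ laplace_sums pure_laplace_sums])
  fix k
  have "c_up \<beta> n \<le> c * \<beta>\<^sup>2"
    using c_up_le by (rule order_trans) (use c in \<open>intro mult_right_mono, auto\<close>)
  then have "exp (c_up \<beta> n * k) \<le> exp (c * \<beta>\<^sup>2) ^ k"
    by (simp add: mult_left_mono mult.commute flip: exp_of_nat_mult)
  then have "exp (c_up \<beta> n * k) * pure_moment B n k \<le> exp (c * \<beta>\<^sup>2) ^ k * pure_moment B n k"
    by (intro mult_right_mono pure_moment_nonneg)
  then have "moment B \<kappa> \<beta> (h_c \<beta>) n k \<le> exp (c * \<beta>\<^sup>2) ^ k * pure_moment B n k"
    by (rule order_trans[OF moment_le[OF \<beta>_small critical_partition_le]])
  then have "u ^ k / fact k * moment B \<kappa> \<beta> (h_c \<beta>) n k \<le> u ^ k / fact k * (exp (c * \<beta>\<^sup>2) ^ k * pure_moment B n k)"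
    using \<open>0 \<le> u\<close> by (intro mult_left_mono) auto
  then show "u ^ k / fact k * moment B \<kappa> \<beta> (h_c \<beta>) n k \<le> (exp (c * \<beta>\<^sup>2) * u) ^ k / fact k * pure_moment B n k"
    by (simp add: power_mult_distrib mult_ac)
qed

text \<open>Rescaling \<open>u\<close> does not touch the coefficient at \<open>k = 0\<close>, so
  the deficit of the partition function is subtracted there as a series with a single term.\<close>

lemma critical_laplace_ge:
  assumes \<beta>_small: "8 * A * \<beta>\<^sup>2 \<le> 1 - \<rho>" "deficit_const * \<beta>\<^sup>2 \<le> (2 - B) / 2"
    and c: "2 * deficit_const * (1 + 1 / (1 - q)) \<le> c" and "0 \<le> u"
  shows "pure_laplace n (exp (- c * \<beta>\<^sup>2) * u) - deficit_const * \<beta>\<^sup>2 * q ^ n \<le> critical_laplace \<beta> n u"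
proof (rule sums_le[OF _ sums_diff[OF pure_laplace_sums sums_single[of 0 "\<lambda>_. deficit_const * \<beta>\<^sup>2 * q ^ n"]] laplace_sums])
  fix k
  show "(exp (- c * \<beta>\<^sup>2) * u) ^ k / fact k * pure_moment B n k - (if k = 0 then deficit_const * \<beta>\<^sup>2 * q ^ n else 0) \<le>
    u ^ k / fact k * moment B \<kappa> \<beta> (h_c \<beta>) n k"
  proof (cases "k = 0")
    case True
    then show ?thesis
      using critical_partition_ge[OF \<beta>_small, of n] by (simp add: pure_moment_0_right)
  next
    case False
    have "c_low \<beta> n \<le> c * \<beta>\<^sup>2"
      using c_low_le[OF \<beta>_small] by (rule order_trans) (use c in \<open>intro mult_right_mono, auto\<close>)
    then have "exp (- c * \<beta>\<^sup>2) ^ k \<le> exp (- (c_low \<beta> n * k))"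
      by (simp add: mult_left_mono mult.commute flip: exp_of_nat_mult)
    then have "exp (- c * \<beta>\<^sup>2) ^ k * pure_moment B n k \<le> exp (- (c_low \<beta> n * k)) * pure_moment B n k"
      by (intro mult_right_mono pure_moment_nonneg)
    also have "\<dots> \<le> moment B \<kappa> \<beta> (h_c \<beta>) n k"
      by (rule critical_moment_ge[OF \<beta>_small False])
    finally have "u ^ k / fact k * (exp (- c * \<beta>\<^sup>2) ^ k * pure_moment B n k) \<le> u ^ k / fact k * moment B \<kappa> \<beta> (h_c \<beta>) n k"
      using \<open>0 \<le> u\<close> by (intro mult_left_mono) auto
    then show ?thesis
      using False by (simp add: power_mult_distrib mult_ac)
  qed
qed

section \<open>From Laplace transforms to free energies\<close>

lemma free_energy_le:
  assumes "\<And>n. critical_laplace \<beta> n u \<le> pure_laplace n v"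
  shows "annealed_free_energy B \<kappa> \<beta> (h_c \<beta> + u) \<le> pure_free_energy B v"
proof (rule LIMSEQ_le[OF free_energy_LIMSEQ pure_free_energy_LIMSEQ])
  have "ln (moment B \<kappa> \<beta> (h_c \<beta> + u) n 0) / 2 ^ n \<le> ln (pure_laplace n v) / 2 ^ n" for n
    using assms[of n] partition_pos[of \<beta> "h_c \<beta> + u" n] unfolding critical_laplace_eq
    by (intro divide_right_mono ln_mono) auto
  then show "\<exists>N. \<forall>n\<ge>N. ln (moment B \<kappa> \<beta> (h_c \<beta> + u) n 0) / 2 ^ n \<le> ln (pure_laplace n v) / 2 ^ n"
    by blast
qed

text \<open>As the pure transform is at least 1, subtracting \<delta> costs at most the factor
  \<open>1 - \<delta>\<close>, whose logarithm disappears after division by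
  \<open>2 ^ n\<close>.\<close>

lemma free_energy_ge:
  assumes ge: "\<And>n. pure_laplace n v - \<delta> \<le> critical_laplace \<beta> n u"
    and "0 \<le> v" "0 \<le> \<delta>" "\<delta> < 1"
  shows "pure_free_energy B v \<le> annealed_free_energy B \<kappa> \<beta> (h_c \<beta> + u)"
proof (rule LIMSEQ_le[OF _ free_energy_LIMSEQ])
  have "(\<lambda>n. ln (1 - \<delta>) * (1 / 2) ^ n) \<longlonglongrightarrow> ln (1 - \<delta>) * 0"
    by (intro tendsto_intros LIMSEQ_power_zero) auto
  from tendsto_add[OF pure_free_energy_LIMSEQ[of v] this]
  show "(\<lambda>n. (ln (pure_laplace n v) + ln (1 - \<delta>)) / 2 ^ n) \<longlonglongrightarrow> pure_free_energy B v"
    by (simp add: power_one_over add_divide_distrib)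
  have "(ln (pure_laplace n v) + ln (1 - \<delta>)) / 2 ^ n \<le> ln (moment B \<kappa> \<beta> (h_c \<beta> + u) n 0) / 2 ^ n" for n
  proof (rule divide_right_mono)
    have \<phi>: "1 \<le> pure_laplace n v"
      using \<open>0 \<le> v\<close> by (rule pure_laplace_ge_1)
    have "pure_laplace n v * (1 - \<delta>) \<le> pure_laplace n v - \<delta>"
      using mult_right_mono[OF \<phi> \<open>0 \<le> \<delta>\<close>] by (simp add: algebra_simps)
    also have "\<dots> \<le> moment B \<kappa> \<beta> (h_c \<beta> + u) n 0"
      using ge unfolding critical_laplace_eq .
    finally have "ln (pure_laplace n v * (1 - \<delta>)) \<le> ln (moment B \<kappa> \<beta> (h_c \<beta> + u) n 0)"
      using \<phi> \<open>\<delta> < 1\<close> by (intro ln_mono) auto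
    also have "ln (pure_laplace n v * (1 - \<delta>)) = ln (pure_laplace n v) + ln (1 - \<delta>)"
      using \<phi> \<open>\<delta> < 1\<close> by (intro ln_mult_pos) auto
    finally show "ln (pure_laplace n v) + ln (1 - \<delta>) \<le> ln (moment B \<kappa> \<beta> (h_c \<beta> + u) n 0)" .
  qed simp
  then show "\<exists>N. \<forall>n\<ge>N. (ln (pure_laplace n v) + ln (1 - \<delta>)) / 2 ^ n \<le> ln (moment B \<kappa> \<beta> (h_c \<beta> + u) n 0) / 2 ^ n"
    by blast
qed

end

theorem theorem3p1:
  fixes B \<kappa> :: real
  assumes "1 < B" "B < 2"
    and "0 < \<kappa>" "\<kappa> < min (B\<^sup>2 / 4) (1 / 2)"
  shows "\<exists>\<beta>\<^sub>0>0. \<exists>c\<^sub>1>0. \<exists>c\<^sub>2>0. \<forall>\<beta>\<in>{0..\<beta>\<^sub>0}. \<forall>u\<in>{0..1}.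
    (\<forall>n.
      - c\<^sub>2 * \<beta>\<^sup>2 * (4 * \<kappa> / B\<^sup>2) ^ n +
        measure_pmf.expectation (GW_law B n) (\<lambda>w. exp (exp (- c\<^sub>1 * \<beta>\<^sup>2) * u * leaves n w))
      \<le> measure_pmf.expectation (GW_law B n)
          (\<lambda>w. exp (u * leaves n w) *
               exp (annealed_hamiltonian \<kappa> \<beta> (annealed_critical_point B \<kappa> \<beta>) n w)) \<and>
      measure_pmf.expectation (GW_law B n)
          (\<lambda>w. exp (u * leaves n w) *
               exp (annealed_hamiltonian \<kappa> \<beta> (annealed_critical_point B \<kappa> \<beta>) n w))
      \<le> measure_pmf.expectation (GW_law B n) (\<lambda>w. exp (exp (c\<^sub>1 * \<beta>\<^sup>2) * u * leaves n w))) \<and>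
    pure_free_energy B (exp (- c\<^sub>1 * \<beta>\<^sup>2) * u)
      \<le> annealed_free_energy B \<kappa> \<beta> (annealed_critical_point B \<kappa> \<beta> + u) \<and>
    annealed_free_energy B \<kappa> \<beta> (annealed_critical_point B \<kappa> \<beta> + u)
      \<le> pure_free_energy B (exp (c\<^sub>1 * \<beta>\<^sup>2) * u)"
proof -
  interpret hierarchical_pinning B \<kappa>
    using assms by unfold_locales auto
  \<comment> \<open>\<open>s\<close> bounds \<open>\<beta>\<^sup>2\<close> so that both smallness
    conditions hold; \<open>sqrt s\<close> then serves as the range of \<beta>.\<close>
  define s where "s = min ((1 - \<rho>) / (8 * A)) ((2 - B) / (2 * deficit_const))"
  define c where "c = max (4 * A / (1 - \<rho>)) (2 * deficit_const * (1 + 1 / (1 - q)))"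
  have s_pos: "0 < s"
    using \<rho>_bounds A_pos deficit_const_pos B_less_2 by (simp add: s_def)
  have "0 < 4 * A / (1 - \<rho>)"
    using \<rho>_bounds A_pos by simp
  then have c_pos: "0 < c"
    by (simp add: c_def less_max_iff_disj)
  have lower: "pure_laplace n (exp (- c * \<beta>\<^sup>2) * u) - deficit_const * \<beta>\<^sup>2 * q ^ n \<le> critical_laplace \<beta> n u"
    and upper: "critical_laplace \<beta> n u \<le> pure_laplace n (exp (c * \<beta>\<^sup>2) * u)"
    and energy_lower: "pure_free_energy B (exp (- c * \<beta>\<^sup>2) * u) \<le> annealed_free_energy B \<kappa> \<beta> (h_c \<beta> + u)"
    and energy_upper: "annealed_free_energy B \<kappa> \<beta> (h_c \<beta> + u) \<le> pure_free_energy B (exp (c * \<beta>\<^sup>2) * u)"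
    if "\<beta> \<in> {0..sqrt s}" "u \<in> {0..1}" for \<beta> u n
  proof -
    have "\<beta>\<^sup>2 \<le> s"
      using that s_pos power_mono[of \<beta> "sqrt s" 2] by simp
    then have \<beta>_small: "8 * A * \<beta>\<^sup>2 \<le> 1 - \<rho>" "deficit_const * \<beta>\<^sup>2 \<le> (2 - B) / 2"
      using A_pos deficit_const_pos by (auto simp: s_def field_simps)
    have u: "0 \<le> u"
      using that by simp
    have lower': "pure_laplace n (exp (- c * \<beta>\<^sup>2) * u) - deficit_const * \<beta>\<^sup>2 * q ^ n \<le> critical_laplace \<beta> n u" for n
      using critical_laplace_ge[OF \<beta>_small _ u] by (simp add: c_def)
    have upper': "critical_laplace \<beta> n u \<le> pure_laplace n (exp (c * \<beta>\<^sup>2) * u)" for n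
      using critical_laplace_le[OF \<beta>_small(1) _ u] by (simp add: c_def)
    show "pure_laplace n (exp (- c * \<beta>\<^sup>2) * u) - deficit_const * \<beta>\<^sup>2 * q ^ n \<le> critical_laplace \<beta> n u"
      "critical_laplace \<beta> n u \<le> pure_laplace n (exp (c * \<beta>\<^sup>2) * u)"
      by (fact lower' upper')+
    show "annealed_free_energy B \<kappa> \<beta> (h_c \<beta> + u) \<le> pure_free_energy B (exp (c * \<beta>\<^sup>2) * u)"
      by (rule free_energy_le[OF upper'])
    show "pure_free_energy B (exp (- c * \<beta>\<^sup>2) * u) \<le> annealed_free_energy B \<kappa> \<beta> (h_c \<beta> + u)"
    proof (rule free_energy_ge)
      \<comment> \<open>The deficit is replaced by a bound below 1 that does not depend on
        \<open>n\<close>.\<close>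
      show "pure_laplace n (exp (- c * \<beta>\<^sup>2) * u) - (2 - B) / 2 \<le> critical_laplace \<beta> n u" for n
        using lower'[of n] deficit_bounds(2)[OF \<beta>_small, of n] by linarith
    qed (use u B_gt_1 B_less_2 in auto)
  qed
  show ?thesis
  proof (rule exI[of _ "sqrt s"], rule conjI, use s_pos in simp, rule exI[of _ c], rule conjI,
      use c_pos in simp, rule exI[of _ deficit_const], intro conjI ballI allI)
    fix \<beta> u :: real and n :: nat
    assume *: "\<beta> \<in> {0..sqrt s}" "u \<in> {0..1}"
    show "- deficit_const * \<beta>\<^sup>2 * (4 * \<kappa> / B\<^sup>2) ^ n + pure_laplace n (exp (- c * \<beta>\<^sup>2) * u) \<le> critical_laplace \<beta> n u"
      using lower[OF *, of n] by (simp add: q_def)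
  qed (use deficit_const_pos upper energy_lower energy_upper in auto)
qed

end
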